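(* For any positive integer $m$ and any $t\in(0,\infty)$, $$\lim_{\substack{p\to\infty\\ p\text{ prime}}}|tC^{\mathrm{eucl}}_{mp}|_{\mathrm{Rips}}=e^{-2t}+2\pi t\sum_{\text{odd }r\mid m}\frac1r\,e^{-2t\cos\left(\frac{\pi}{2r}\right)}\sin\left(\frac{\pi}{2r}\right),$$ where the sum is over the positive odd divisors $r$ of $m$.
   Context: $C_n^{\mathrm{eucl}}$ denotes the set of $n$ equidistant points on the unit circle in $\mathbb{R}^2$ with the Euclidean metric. For a finite metric space $X$, the Rips magnitude function $|tX|_{\mathrm{Rips}}$ is the persistent magnitude function of the persistent homology of its Vietoris–Rips complex; equivalently, it is given for $t\in(0,\infty)$ by $|tX|_{\mathrm{Rips}}=\sum_{\emptyset\ne A\subseteq X}(-1)^{\#A-1}e^{-\mathrm{diam}(A)t}$. *)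

theory Defs
  imports
    "HOL-Analysis.Analysis"
    "HOL-Library.Function_Algebras"
    "HOL-Computational_Algebra.Primes"
begin

section \<open>Simplicial chains with coefficients in a field\<close>

definition fun_scale :: "'k::field \<Rightarrow> ('b \<Rightarrow> 'k) \<Rightarrow> 'b \<Rightarrow> 'k" where
  "fun_scale c f = (\<lambda>x. c * f x)"

global_interpretation fun_space: vector_space fun_scale
  by unfold_locales (auto simp: fun_scale_def algebra_simps fun_eq_iff)

text \<open>
  A simplicial complex on a vertex set is given by its set \<open>K\<close> of nonempty finite simplices.
  An oriented \<open>k\<close>-chain is encoded by the alternating function that sends the vertex list
  \<open>[v\<^sub>0, \<dots>, v\<^sub>k]\<close> to the coefficient of the oriented simplex spanned by that list; reordering the
  list changes the coefficient by the sign of the permutation.  This avoids choosing a linear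
  order on the vertices.
\<close>

definition simplicial_chains :: "'a set set \<Rightarrow> nat \<Rightarrow> ('a list \<Rightarrow> 'k::field) set" where
  "simplicial_chains K k = {c.
     (\<forall>vs. c vs \<noteq> 0 \<longrightarrow> length vs = Suc k \<and> distinct vs \<and> set vs \<in> K) \<and>
     (\<forall>us x y vs. c (us @ y # x # vs) = - c (us @ x # y # vs))}"

text \<open>
  In the boundary of an oriented simplex, the coefficient of \<open>[w\<^sub>1, \<dots>, w\<^sub>k]\<close> collects the
  coefficients of all \<open>[v, w\<^sub>1, \<dots>, w\<^sub>k]\<close>: the face opposite to the leading vertex carries sign
  \<open>+1\<close>.  The value at the empty list is \<open>0\<close> because homology is not reduced.
\<close>

definition boundary :: "'a set \<Rightarrow> ('a list \<Rightarrow> 'k::field) \<Rightarrow> 'a list \<Rightarrow> 'k" where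
  "boundary V c = (\<lambda>ws. if ws = [] then 0 else \<Sum>v\<in>V. c (v # ws))"

definition cycles :: "'a set \<Rightarrow> 'a set set \<Rightarrow> nat \<Rightarrow> ('a list \<Rightarrow> 'k::field) set" where
  "cycles V K k = {c \<in> simplicial_chains K k. boundary V c = 0}"

definition boundaries :: "'a set \<Rightarrow> 'a set set \<Rightarrow> nat \<Rightarrow> ('a list \<Rightarrow> 'k::field) set" where
  "boundaries V K k = boundary V ` simplicial_chains K (Suc k)"

section \<open>Persistent homology of the Vietoris--Rips filtration\<close>

definition rips_complex :: "'a::metric_space set \<Rightarrow> real \<Rightarrow> 'a set set" where
  "rips_complex X r = {A. A \<subseteq> X \<and> finite A \<and> A \<noteq> {} \<and> diameter A \<le> r}"

text \<open>
  For \<open>r \<le> s\<close> this is the rank of the map \<open>H\<^sub>k(R\<^sub>r X) \<rightarrow> H\<^sub>k(R\<^sub>s X)\<close> induced by the inclusion of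
  Rips complexes, whose image is isomorphic to \<open>Z\<^sub>k(R\<^sub>r X) / (Z\<^sub>k(R\<^sub>r X) \<inter> B\<^sub>k(R\<^sub>s X))\<close>.
  The first argument fixes the coefficient field.
\<close>

definition rips_homology_rank ::
  "'k::field itself \<Rightarrow> 'a::metric_space set \<Rightarrow> nat \<Rightarrow> real \<Rightarrow> real \<Rightarrow> nat" where
  "rips_homology_rank _ X k r s =
     fun_space.dim (cycles X (rips_complex X r) k :: ('a list \<Rightarrow> 'k) set) -
     fun_space.dim (cycles X (rips_complex X r) k \<inter> boundaries X (rips_complex X s) k
                     :: ('a list \<Rightarrow> 'k) set)"

section \<open>Persistent magnitude\<close>

text \<open>
  The barcode of a persistence module is read off from its ranks \<open>\<rho> r s\<close>: the following two
  functions give the number of half-open bars \<open>[a, b)\<close> and \<open>[a, \<infinity>)\<close>.  For the modules in question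
  the functions under the one-sided limits are eventually constant.
\<close>

definition bar_mult :: "(real \<Rightarrow> real \<Rightarrow> nat) \<Rightarrow> real \<Rightarrow> real \<Rightarrow> real" where
  "bar_mult \<rho> a b =
     Lim (at_right 0) (\<lambda>\<epsilon>. (real (\<rho> a (b - \<epsilon>)) - real (\<rho> a b))
                         - (real (\<rho> (a - \<epsilon>) (b - \<epsilon>)) - real (\<rho> (a - \<epsilon>) b)))"

definition inf_bar_mult :: "(real \<Rightarrow> real \<Rightarrow> nat) \<Rightarrow> real \<Rightarrow> real" where
  "inf_bar_mult \<rho> a =
     Lim at_top (\<lambda>s. Lim (at_right 0) (\<lambda>\<epsilon>. real (\<rho> a s) - real (\<rho> (a - \<epsilon>) s)))"

definition persistent_magnitude :: "(real \<Rightarrow> real \<Rightarrow> nat) \<Rightarrow> real \<Rightarrow> real" where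
  "persistent_magnitude \<rho> t =
     (\<Sum>(a, b) | a < b \<and> bar_mult \<rho> a b \<noteq> 0. bar_mult \<rho> a b * (exp (- a * t) - exp (- b * t)))
     + (\<Sum>a | inf_bar_mult \<rho> a \<noteq> 0. inf_bar_mult \<rho> a * exp (- a * t))"

text \<open>
  A complex on the vertex set \<open>X\<close> has homology only in degrees below \<open>card X\<close>.
\<close>

definition rips_magnitude ::
  "'k::field itself \<Rightarrow> 'a::metric_space set \<Rightarrow> real \<Rightarrow> real" where
  "rips_magnitude F X t =
     (\<Sum>k<card X. (- 1) ^ k * persistent_magnitude (rips_homology_rank F X k) t)"

section \<open>Equidistant points on the unit circle\<close>

definition circle_points :: "nat \<Rightarrow> (real^2) set" where
  "circle_points n =
     (\<lambda>k. vector [cos (2 * pi * real k / real n), sin (2 * pi * real k / real n)]) ` {..<n}"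

section \<open>The alternating-sum formula\<close>

lemma fun_rank_nullity:
  fixes f :: "('a \<Rightarrow> 'k::field) \<Rightarrow> ('b \<Rightarrow> 'k)"
  assumes lf: "Vector_Spaces.linear fun_scale fun_scale f"
    and C: "fun_space.subspace C" "C \<subseteq> fun_space.span W" "finite W"
  shows "fun_space.dim C = fun_space.dim {c \<in> C. f c = 0} + fun_space.dim (f ` C)"
proof -
  interpret l: Vector_Spaces.linear fun_scale fun_scale f by (rule lf)
  let ?N = "{c \<in> C. f c = 0}"
  obtain B where B: "B \<subseteq> ?N" "fun_space.independent B" "?N \<subseteq> fun_space.span B" "card B = fun_space.dim ?N"
    using fun_space.basis_exists by blast
  obtain B' where B': "B \<subseteq> B'" "B' \<subseteq> C" "fun_space.independent B'" "C \<subseteq> fun_space.span B'"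
    using fun_space.maximal_independent_subset_extend[of B C] B by auto
  have fin: "finite B'" using fun_space.independent_span_bound[OF C(3) B'(3)] B'(2) C(2) by auto
  define D where "D = B' - B"
  have spB: "fun_space.span B \<subseteq> C" "fun_space.span B' \<subseteq> C" "fun_space.span D \<subseteq> C"
    by (rule fun_space.span_minimal[OF _ C(1)]; use B(1) B'(1,2) in \<open>auto simp: D_def\<close>)+
  have finB: "finite B" "finite D" using fin B'(1) finite_subset unfolding D_def by auto
  have disj: "x = 0" if x: "x \<in> fun_space.span D" "x \<in> fun_space.span B" for x
  proof -
    obtain r where r: "x = (\<Sum>b\<in>B. fun_scale (r b) b)" using x(2) fun_space.span_finite[OF finB(1)] by auto
    obtain q where q: "x = (\<Sum>b\<in>D. fun_scale (q b) b)" using x(1) fun_space.span_finite[OF finB(2)] by auto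
    define h where "h b = (if b \<in> B then r b else - q b)" for b
    have "(\<Sum>b\<in>B'. fun_scale (h b) b) = (\<Sum>b\<in>B. fun_scale (h b) b) + (\<Sum>b\<in>D. fun_scale (h b) b)"
      using fin B'(1) unfolding D_def by (simp add: sum.subset_diff add.commute)
    also have "(\<Sum>b\<in>B. fun_scale (h b) b) = x" unfolding r by (rule sum.cong) (auto simp: h_def)
    also have "(\<Sum>b\<in>D. fun_scale (h b) b) = - x" unfolding q sum_negf[symmetric]
      by (rule sum.cong) (auto simp: h_def D_def)
    finally have "(\<Sum>b\<in>B'. fun_scale (h b) b) = 0" by (simp only: right_minus)
    then have "h b = 0" if "b \<in> B'" for b
      using fun_space.independentD[OF B'(3) fin subset_refl] that by blast
    then have "r b = 0" if "b \<in> B" for b using that B'(1) unfolding h_def by (metis subsetD)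
    then have "fun_scale (r b) b = 0" if "b \<in> B" for b using that by (simp add: fun_scale_def fun_eq_iff)
    then show ?thesis unfolding r by (rule sum.neutral[OF ballI])
  qed
  have inj: "inj_on f (fun_space.span D)"
  proof (subst l.inj_on_iff_eq_0[OF fun_space.subspace_span], intro ballI impI)
    fix x assume x: "x \<in> fun_space.span D" "f x = 0"
    then have "x \<in> ?N" using spB(3) by auto
    then show "x = 0" using disj x(1) B(3) by auto
  qed
  have indD: "fun_space.independent D"
    using B'(3) fun_space.independent_mono unfolding D_def by blast
  have ind: "fun_space.independent (f ` D)"
    by (rule l.independent_injective_image[OF indD inj])
  have cd: "card (f ` D) = card D"
    by (rule card_image) (rule inj_on_subset[OF inj fun_space.span_superset])
  have "f ` C \<subseteq> fun_space.span (f ` D)"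
  proof
    fix y assume "y \<in> f ` C"
    then obtain x where x: "x \<in> C" "y = f x" by auto
    have "f ` B' \<subseteq> fun_space.span (f ` D)"
    proof
      fix z assume "z \<in> f ` B'"
      then obtain b where b: "b \<in> B'" "z = f b" by auto
      show "z \<in> fun_space.span (f ` D)"
      proof (cases "b \<in> B")
        case True
        then have "z = 0" using b B(1) by auto
        then show ?thesis using fun_space.span_zero by blast
      next
        case False
        then show ?thesis using b unfolding D_def by (auto intro: fun_space.span_base)
      qed
    qed
    then have "fun_space.span (f ` B') \<subseteq> fun_space.span (f ` D)"
      by (rule fun_space.span_minimal) (rule fun_space.subspace_span)
    moreover have "y \<in> f ` fun_space.span B'" using x B'(4) by auto
    ultimately show "y \<in> fun_space.span (f ` D)" using l.span_image by auto
  qed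
  then have "fun_space.dim (f ` C) = card (f ` D)"
    using B'(2) ind by (intro fun_space.basis_card_eq_dim[symmetric]) (auto simp: D_def)
  moreover have "fun_space.dim C = card B'"
    using B' by (intro fun_space.basis_card_eq_dim[symmetric])
  moreover have "card B' = card B + card D"
    unfolding D_def using fin B'(1) by (metis card_Diff_subset card_mono finB(1) le_add_diff_inverse)
  ultimately show ?thesis using cd B(4) by simp
qed

text \<open>
  \<open>simplex_chain f A\<close> below is the oriented simplex \<open>A\<close> with vertices ordered by \<open>f\<close>; the sign of a
  vertex list is the parity of its inversions with respect to \<open>f\<close>.
\<close>

fun inversions :: "('a \<Rightarrow> nat) \<Rightarrow> 'a list \<Rightarrow> nat" where
  "inversions f [] = 0"
| "inversions f (x # xs) = length (filter (\<lambda>y. f y < f x) xs) + inversions f xs"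

lemma inversions_swap: "f x \<noteq> f y \<Longrightarrow> (-1::'k::field) ^ inversions f (us @ y # x # vs) = - ((-1) ^ inversions f (us @ x # y # vs))"
proof (induction us)
  case Nil
  then show ?case by (auto simp: power_add)
next
  case (Cons u us)
  then show ?case by (auto simp: power_add)
qed

lemma swap_inv_front:
  assumes "\<And>us x y vs. g (us @ y # x # vs) = g (us @ x # y # vs)"
  shows "g (ps @ us @ x # vs) = g (ps @ x # us @ vs)"
proof (induction us arbitrary: vs rule: rev_induct)
  case Nil show ?case by simp
next
  case (snoc u us)
  have "g (ps @ (us @ [u]) @ x # vs) = g ((ps @ us) @ u # x # vs)" by simp
  also have "\<dots> = g ((ps @ us) @ x # u # vs)" by (rule assms)
  also have "\<dots> = g (ps @ us @ x # (u # vs))" by simp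
  also have "\<dots> = g (ps @ x # us @ u # vs)" by (rule snoc)
  finally show ?case by simp
qed

lemma swap_inv_mset:
  assumes "\<And>us x y vs. g (us @ y # x # vs) = g (us @ x # y # vs)"
  shows "mset xs = mset ys \<Longrightarrow> g (ps @ xs) = g (ps @ ys)"
proof (induction xs arbitrary: ys ps)
  case Nil then show ?case by simp
next
  case (Cons x xs)
  then have "x \<in> set ys" by (metis list.set_intros(1) set_mset_mset)
  then obtain us vs where ys: "ys = us @ x # vs" by (meson split_list)
  have "mset xs = mset (us @ vs)" using Cons.prems unfolding ys by simp
  then have "g ((ps @ [x]) @ xs) = g ((ps @ [x]) @ us @ vs)" by (rule Cons.IH)
  also have "\<dots> = g (ps @ ys)" unfolding ys using swap_inv_front[of g ps us x vs, OF assms] by simp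
  finally show ?case by simp
qed

lemma chainsD:
  assumes "c \<in> simplicial_chains K k"
  shows "c vs \<noteq> 0 \<Longrightarrow> length vs = Suc k" "c vs \<noteq> 0 \<Longrightarrow> distinct vs" "c vs \<noteq> 0 \<Longrightarrow> set vs \<in> K"
    "c (us @ y # x # ws) = - c (us @ x # y # ws)"
  using assms unfolding simplicial_chains_def by blast+

lemma subspace_chains: "fun_space.subspace (simplicial_chains K k :: ('a list \<Rightarrow> 'b::field) set)"
proof -
  have "x + y \<in> simplicial_chains K k" if x: "x \<in> simplicial_chains K k" and y: "y \<in> simplicial_chains K k" for x y :: "'a list \<Rightarrow> 'b"
  proof -
    have "length vs = Suc k \<and> distinct vs \<and> set vs \<in> K" if "x vs + y vs \<noteq> 0" for vs
      using that chainsD(1-3)[OF x, of vs] chainsD(1-3)[OF y, of vs] by (cases "x vs = 0") auto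
    moreover have "x (us @ v # u # vs) + y (us @ v # u # vs) = - (x (us @ u # v # vs) + y (us @ u # v # vs))" for us u v vs
      unfolding chainsD(4)[OF x, of us v u vs] chainsD(4)[OF y, of us v u vs] by simp
    ultimately show ?thesis unfolding simplicial_chains_def plus_fun_def by blast
  qed
  moreover have "fun_scale a x \<in> simplicial_chains K k" if x: "x \<in> simplicial_chains K k" for a and x :: "'a list \<Rightarrow> 'b"
  proof -
    have "length vs = Suc k \<and> distinct vs \<and> set vs \<in> K" if "a * x vs \<noteq> 0" for vs
      using that chainsD(1-3)[OF x, of vs] by (cases "x vs = 0") auto
    moreover have "a * x (us @ v # u # vs) = - (a * x (us @ u # v # vs))" for us u v vs
      unfolding chainsD(4)[OF x, of us v u vs] by simp
    ultimately show ?thesis unfolding simplicial_chains_def fun_scale_def by blast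
  qed
  moreover have "0 \<in> simplicial_chains K k" unfolding simplicial_chains_def by simp
  ultimately show ?thesis unfolding fun_space.subspace_def by blast
qed

definition simplex_chain :: "('a \<Rightarrow> nat) \<Rightarrow> 'a set \<Rightarrow> 'a list \<Rightarrow> 'k::field" where
  "simplex_chain f A vs = (if distinct vs \<and> set vs = A then (-1) ^ inversions f vs else 0)"

lemma simplex_chain_in_chains:
  assumes "inj_on f A" "A \<in> K" "card A = Suc k"
  shows "simplex_chain f A \<in> simplicial_chains K k"
proof -
  have "simplex_chain f A (us @ y # x # vs) = - (simplex_chain f A (us @ x # y # vs) :: 'b)" for us x y vs
  proof (cases "distinct (us @ y # x # vs) \<and> set (us @ y # x # vs) = A")
    case True
    then have "f x \<noteq> f y" using assms(1) by (auto dest: inj_onD)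
    from inversions_swap[of f, OF this] True show ?thesis unfolding simplex_chain_def
      by (auto simp: insert_commute)
  next
    case False
    then show ?thesis unfolding simplex_chain_def by (auto simp: insert_commute)
  qed
  moreover have "length vs = Suc k \<and> distinct vs \<and> set vs \<in> K" if "(simplex_chain f A vs :: 'b) \<noteq> 0" for vs
    using that assms distinct_card[of vs] unfolding simplex_chain_def by (auto split: if_splits)
  ultimately show ?thesis unfolding simplicial_chains_def by blast
qed

lemma dim_chains:
  fixes K :: "'a set set" and k :: nat
  assumes X: "finite X" "\<And>A. A \<in> K \<Longrightarrow> A \<subseteq> X"
  defines "S \<equiv> {A \<in> K. card A = Suc k}"
  shows "fun_space.dim (simplicial_chains K k :: ('a list \<Rightarrow> 'k::field) set) = card S"
    and "\<exists>W. finite W \<and> (simplicial_chains K k :: ('a list \<Rightarrow> 'k::field) set) \<subseteq> fun_space.span W"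
proof -
  obtain f :: "'a \<Rightarrow> nat" where f: "inj_on f X" using finite_imp_inj_to_nat_seg[OF X(1)] by auto
  have finS: "finite S" unfolding S_def by (rule finite_subset[of _ "Pow X"]) (use X in auto)
  have "\<exists>l. distinct l \<and> set l = A" if "A \<in> S" for A
    using that X finite_distinct_list finite_subset unfolding S_def by (metis (lifting) mem_Collect_eq)
  then obtain l where l: "\<And>A. A \<in> S \<Longrightarrow> distinct (l A) \<and> set (l A) = A" by metis
  let ?e = "simplex_chain f :: 'a set \<Rightarrow> 'a list \<Rightarrow> 'k"
  have ev: "?e A (l B) = (if A = B then (-1) ^ inversions f (l B) else 0)" if "A \<in> S" "B \<in> S" for A B
    using l[OF that(2)] unfolding simplex_chain_def by auto
  have inj: "inj_on ?e S"
  proof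
    fix A B assume A: "A \<in> S" "B \<in> S" "?e A = ?e B"
    show "A = B"
    proof (rule ccontr)
      assume "A \<noteq> B"
      then have "?e B (l A) = 0" using ev[OF A(2) A(1)] by simp
      moreover have "?e A (l A) \<noteq> 0" using ev[OF A(1) A(1)] by simp
      ultimately show False using A(3) by metis
    qed
  qed
  have ech: "?e ` S \<subseteq> simplicial_chains K k"
  proof
    fix y assume "y \<in> ?e ` S"
    then obtain A where A: "A \<in> K" "card A = Suc k" "y = ?e A" unfolding S_def by blast
    have "inj_on f A" using inj_on_subset[OF f X(2)[OF A(1)]] .
    then show "y \<in> simplicial_chains K k" unfolding A(3) using A(1,2) by (rule simplex_chain_in_chains)
  qed
  have zero: "u (?e A) = 0" if "(\<Sum>v\<in>?e ` S. fun_scale (u v) v) = 0" "A \<in> S" for u A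
  proof -
    have "0 = (\<Sum>v\<in>?e ` S. fun_scale (u v) v) (l A)" using that by simp
    also have "\<dots> = (\<Sum>B\<in>S. fun_scale (u (?e B)) (?e B)) (l A)"
      by (simp add: sum.reindex[OF inj])
    also have "\<dots> = (\<Sum>B\<in>S. u (?e B) * ?e B (l A))"
      using finS by (induction S rule: finite_induct) (auto simp: fun_scale_def)
    also have "\<dots> = (\<Sum>B\<in>S. if B = A then u (?e A) * (-1) ^ inversions f (l A) else 0)"
      by (rule sum.cong) (use ev that in auto)
    also have "\<dots> = u (?e A) * (-1) ^ inversions f (l A)" using finS that by simp
    finally show ?thesis by simp
  qed
  have ind: "fun_space.independent (?e ` S)"
    by (rule fun_space.independent_if_scalars_zero) (use finS zero in auto)
  have sp: "c \<in> fun_space.span (?e ` S)" if c: "c \<in> simplicial_chains K k" for c :: "'a list \<Rightarrow> 'k"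
  proof -
    define g where "g vs = c vs * (-1) ^ inversions f vs" for vs
    have g: "g (us @ y # x # vs) = g (us @ x # y # vs)" for us x y vs
    proof (cases "c (us @ x # y # vs) = 0")
      case True
      then show ?thesis unfolding g_def using chainsD(4)[OF c, of us y x vs] by simp
    next
      case False
      from chainsD(2)[OF c False] chainsD(3)[OF c False] have "x \<noteq> y" "x \<in> X" "y \<in> X" using X(2) by auto
      then have "f x \<noteq> f y" using f by (auto dest: inj_onD)
      then have "(-1::'k) ^ inversions f (us @ y # x # vs) = - ((-1) ^ inversions f (us @ x # y # vs))" by (rule inversions_swap)
      then show ?thesis unfolding g_def chainsD(4)[OF c, of us y x vs] by simp
    qed
    have "c = (\<Sum>A\<in>S. fun_scale (g (l A)) (?e A))"
    proof
      fix vs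
      have "(\<Sum>A\<in>S. fun_scale (g (l A)) (?e A)) vs = (\<Sum>A\<in>S. g (l A) * ?e A vs)"
        using finS by (induction S rule: finite_induct) (auto simp: fun_scale_def)
      also have "\<dots> = (\<Sum>A\<in>S. if A = set vs then (if distinct vs then g (l (set vs)) * (-1) ^ inversions f vs else 0) else 0)"
        by (rule sum.cong) (auto simp: simplex_chain_def)
      also have "\<dots> = (if set vs \<in> S \<and> distinct vs then g (l (set vs)) * (-1) ^ inversions f vs else 0)"
        using finS by simp
      also have "\<dots> = c vs"
      proof (cases "set vs \<in> S \<and> distinct vs")
        case True
        then have "mset (l (set vs)) = mset vs" using l[of "set vs"] by (metis set_eq_iff_mset_eq_distinct)
        then have "g ([] @ l (set vs)) = g ([] @ vs)" by (rule swap_inv_mset[of g, OF g])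
        moreover have "(-1::'k) ^ inversions f vs * (-1) ^ inversions f vs = 1" by (rule left_right_inverse_power) simp
        ultimately show ?thesis using True unfolding g_def by (simp add: mult.assoc)
      next
        case False
        then have "c vs = 0" using chainsD[OF c, of vs] distinct_card[of vs] unfolding S_def by force
        then show ?thesis using False by auto
      qed
      finally show "c vs = (\<Sum>A\<in>S. fun_scale (g (l A)) (?e A)) vs" by simp
    qed
    then show ?thesis
      by (metis (no_types, lifting) fun_space.span_base fun_space.span_scale fun_space.span_sum imageI)
  qed
  have "card (?e ` S) = fun_space.dim (simplicial_chains K k :: ('a list \<Rightarrow> 'k) set)"
    by (rule fun_space.basis_card_eq_dim) (use ech ind sp in auto)
  then show "fun_space.dim (simplicial_chains K k :: ('a list \<Rightarrow> 'k::field) set) = card S"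
    by (simp add: card_image[OF inj])
  show "\<exists>W. finite W \<and> (simplicial_chains K k :: ('a list \<Rightarrow> 'k::field) set) \<subseteq> fun_space.span W"
    by (rule exI[of _ "?e ` S"]) (use finS sp in auto)
qed

lemma fun_dim_mono:
  assumes "A \<subseteq> C" "C \<subseteq> fun_space.span W" "finite W"
  shows "fun_space.dim A \<le> fun_space.dim C"
proof -
  obtain B where B: "B \<subseteq> A" "fun_space.independent B" "A \<subseteq> fun_space.span B" "card B = fun_space.dim A"
    using fun_space.basis_exists by blast
  obtain B' where B': "B \<subseteq> B'" "B' \<subseteq> C" "fun_space.independent B'" "C \<subseteq> fun_space.span B'"
    using fun_space.maximal_independent_subset_extend[OF order_trans[OF B(1) assms(1)] B(2)] by blast
  have "finite B'" using fun_space.independent_span_bound[OF assms(3) B'(3)] B'(2) assms(2) by auto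
  moreover have "card B' = fun_space.dim C" using B'(2-4) fun_space.basis_card_eq_dim by blast
  ultimately show ?thesis using B'(1) B(4) card_mono by metis
qed

lemma alt_sum_0:
  fixes a :: "'a \<Rightarrow> 'a \<Rightarrow> 'k::comm_ring"
  assumes "finite X" "\<And>v w. a v w = - a w v" "\<And>v. a v v = 0"
  shows "(\<Sum>v\<in>X. \<Sum>w\<in>X. a v w) = 0"
  using assms(1)
proof (induction X rule: finite_induct)
  case (insert x X)
  have "(\<Sum>v\<in>X. a v x) = - (\<Sum>v\<in>X. a x v)"
    unfolding sum_negf[symmetric] by (rule sum.cong[OF refl assms(2)])
  then show ?case using insert by (simp add: sum.distrib assms(3))
qed simp

locale finite_complex =
  fixes X :: "'a set" and K :: "'a set set" and F :: "'k::field itself"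
  assumes fin: "finite X" and sub: "\<And>A. A \<in> K \<Longrightarrow> A \<subseteq> X"
    and face: "\<And>A B. A \<in> K \<Longrightarrow> B \<subseteq> A \<Longrightarrow> B \<noteq> {} \<Longrightarrow> B \<in> K"
begin

abbreviation "C k \<equiv> (simplicial_chains K k :: ('a list \<Rightarrow> 'k) set)"

lemma lin: "Vector_Spaces.linear fun_scale fun_scale (boundary X :: ('a list \<Rightarrow> 'k) \<Rightarrow> _)"
  unfolding Vector_Spaces.linear_iff
proof (intro conjI allI)
  show "vector_space (fun_scale :: 'k \<Rightarrow> ('a list \<Rightarrow> 'k) \<Rightarrow> _)" by (rule fun_space.vector_space_axioms)
  then show "vector_space (fun_scale :: 'k \<Rightarrow> ('a list \<Rightarrow> 'k) \<Rightarrow> _)" .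
qed (auto simp: fun_eq_iff boundary_def fun_scale_def sum.distrib sum_distrib_left)

lemma boundary_in_chains: "c \<in> C (Suc k) \<Longrightarrow> boundary X c \<in> C k"
proof -
  assume c: "c \<in> C (Suc k)"
  have "length ws = Suc k \<and> distinct ws \<and> set ws \<in> K" if "boundary X c ws \<noteq> 0" for ws
  proof -
    from that have ws: "ws \<noteq> []" "(\<Sum>v\<in>X. c (v # ws)) \<noteq> 0" unfolding boundary_def by (auto split: if_splits)
    then obtain v where "c (v # ws) \<noteq> 0" by (meson sum.neutral)
    from chainsD(1-3)[OF c this] show ?thesis using ws(1) face[of "set (v # ws)" "set ws"] by auto
  qed
  moreover have "boundary X c (us @ y # x # vs) = - boundary X c (us @ x # y # vs)" for us x y vs
    using chainsD(4)[OF c, of "_ # us" y x vs] unfolding boundary_def by (simp add: sum_negf)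
  ultimately show ?thesis unfolding simplicial_chains_def by blast
qed

lemma boundary_boundary: "c \<in> C (Suc k) \<Longrightarrow> boundary X (boundary X c) = 0"
proof
  fix ws assume c: "c \<in> C (Suc k)"
  have "(\<Sum>v\<in>X. \<Sum>w\<in>X. c (w # v # ws)) = 0"
  proof (rule alt_sum_0[OF fin])
    show "c (w # v # ws) = - c (v # w # ws)" for v w using chainsD(4)[OF c, of "[]" w v ws] by simp
    show "c (v # v # ws) = 0" for v using chainsD(2)[OF c, of "v # v # ws"] by auto
  qed
  then show "boundary X (boundary X c) ws = 0 ws" unfolding boundary_def by simp
qed

lemma boundary_degree_0: "c \<in> C 0 \<Longrightarrow> boundary X c = 0"
  using chainsD(1)[of c K 0] unfolding boundary_def fun_eq_iff by (force intro!: sum.neutral)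

definition "n k = fun_space.dim (C k)"
definition "z k = fun_space.dim (cycles X K k :: ('a list \<Rightarrow> 'k) set)"
definition "b k = fun_space.dim (boundaries X K k :: ('a list \<Rightarrow> 'k) set)"

lemma n_eq: "n k = card {A\<in>K. card A = Suc k}"
  unfolding n_def by (rule dim_chains(1)[OF fin sub])

lemma n_0: "n 0 = z 0"
proof -
  have "cycles X K 0 = C 0" using boundary_degree_0 unfolding cycles_def by auto
  then show ?thesis unfolding n_def z_def by simp
qed

lemma n_Suc: "n (Suc k) = z (Suc k) + b k"
proof -
  obtain W where "finite W" "C (Suc k) \<subseteq> fun_space.span W" using dim_chains(2)[OF fin sub] by blast
  from fun_rank_nullity[OF lin subspace_chains this(2,1)]
  show ?thesis unfolding n_def z_def b_def cycles_def boundaries_def by simp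
qed

lemma b_sub: "boundaries X K k \<subseteq> (cycles X K k :: ('a list \<Rightarrow> 'k) set)"
  unfolding boundaries_def cycles_def using boundary_in_chains boundary_boundary by auto

lemma b_le: "b k \<le> z k"
proof -
  obtain W where W: "finite W" "C k \<subseteq> fun_space.span W" using dim_chains(2)[OF fin sub] by blast
  have "cycles X K k \<subseteq> C k" unfolding cycles_def by auto
  then show ?thesis unfolding b_def z_def using W b_sub by (intro fun_dim_mono[of _ _ W]) auto
qed

lemma n_big: "n (card X) = 0"
proof -
  have "card A \<le> card X" if "A \<in> K" for A by (rule card_mono[OF fin sub[OF that]])
  then have "{A\<in>K. card A = Suc (card X)} = {}" by force
  then show ?thesis unfolding n_eq by (simp only: card.empty)
qed

lemma euler: "(\<Sum>k<card X. (-1) ^ k * (real (z k - b k))) = (\<Sum>A\<in>K. (-1) ^ (card A - 1))"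
  if ne: "{} \<notin> K"
proof -
  have 1: "(\<Sum>k<M. (-1) ^ k * (real (z k) - real (b k))) =
    (\<Sum>k<M. (-1) ^ k * real (n k)) + (if M = 0 then 0 else (-1) ^ M * real (b (M - 1)))" for M
  proof (induction M)
    case (Suc M)
    show ?case
    proof (cases M)
      case 0
      then show ?thesis by (simp add: n_0)
    next
      case (Suc m)
      have "(\<Sum>k<Suc M. (-1) ^ k * (real (z k) - real (b k))) =
         (\<Sum>k<M. (-1) ^ k * real (n k)) + (-1) ^ M * real (b m) + (-1) ^ M * (real (z M) - real (b M))"
        using Suc.IH Suc by simp
      also have "\<dots> = (\<Sum>k<M. (-1) ^ k * real (n k)) + (-1) ^ M * (real (z M) + real (b m)) - (-1) ^ M * real (b M)"
        by (simp add: algebra_simps)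
      also have "real (z M) + real (b m) = real (n M)" using n_Suc[of m] Suc by simp
      finally show ?thesis by simp
    qed
  qed simp
  have "b (card X - 1) = 0" if "card X \<noteq> 0"
    using n_big n_Suc[of "card X - 1"] that by simp
  with 1[of "card X"] have "(\<Sum>k<card X. (-1) ^ k * (real (z k - b k))) = (\<Sum>k<card X. (-1) ^ k * real (n k))"
    by (simp add: b_le of_nat_diff)
  also have "\<dots> = (\<Sum>k<card X. \<Sum>A\<in>{A\<in>K. card A - 1 = k}. (-1) ^ (card A - 1))"
  proof (rule sum.cong[OF refl])
    fix k
    have fp: "card A > 0" if "A \<in> K" for A
      using that sub[OF that] fin ne finite_subset by (metis card_gt_0_iff)
    have "{A\<in>K. card A = Suc k} = {A\<in>K. card A - 1 = k}"
      by (auto dest: fp)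
    then have "real (n k) = (\<Sum>A\<in>{A\<in>K. card A - 1 = k}. 1)" unfolding n_eq by simp
    then show "(-1) ^ k * real (n k) = (\<Sum>A\<in>{A\<in>K. card A - 1 = k}. (-1) ^ (card A - 1))"
      by (simp add: sum_distrib_left)
  qed
  also have "\<dots> = (\<Sum>A\<in>K. (-1) ^ (card A - 1))"
  proof (rule sum.group)
    show "finite K" by (rule finite_subset[of _ "Pow X"]) (use fin sub in auto)
    show "(\<lambda>A. card A - 1) ` K \<subseteq> {..<card X}"
    proof
      fix y assume "y \<in> (\<lambda>A. card A - 1) ` K"
      then obtain A where A: "A \<in> K" "y = card A - 1" by auto
      have "card A \<le> card X" "A \<noteq> {}" "finite A" using sub[OF A(1)] fin card_mono A ne finite_subset by auto
      then have "card A > 0" by auto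
      then show "y \<in> {..<card X}" using A \<open>card A \<le> card X\<close> by auto
    qed
  qed simp
  finally show ?thesis .
qed

end

lemma sum_diff_factor:
  fixes s a b :: "nat \<Rightarrow> real"
  shows "(\<Sum>k\<in>I. s k * ((a k - b k) * e)) = ((\<Sum>k\<in>I. s k * a k) - (\<Sum>k\<in>I. s k * b k)) * e"
proof -
  have "(\<Sum>k\<in>I. s k * ((a k - b k) * e)) = (\<Sum>k\<in>I. (s k * a k - s k * b k) * e)"
    by (rule sum.cong) (auto simp: algebra_simps)
  then show ?thesis by (simp only: sum_distrib_right[symmetric] sum_subtractf)
qed

lemma sum_telescope_aux:
  fixes A M E :: "nat \<Rightarrow> real"
  shows "(\<Sum>i\<in>I. A i + M i * (E i - e)) = (\<Sum>i\<in>I. A i) + (\<Sum>i\<in>I. M i * E i) - (\<Sum>i\<in>I. M i) * e"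
  by (simp add: sum.distrib right_diff_distrib sum_subtractf sum_distrib_right)

lemma sum_telescope:
  fixes G :: "nat \<Rightarrow> nat \<Rightarrow> real" and E :: "nat \<Rightarrow> real"
  assumes "\<And>j. G 0 j = 0"
  shows "(\<Sum>i=1..n. \<Sum>j=Suc i..n. (G i (j-1) - G i j - (G (i-1) (j-1) - G (i-1) j)) * (E i - E j))
    + (\<Sum>i=1..n. (G i n - G (i-1) n) * E i) = (\<Sum>i=1..n. (G i i - G (i-1) (i-1)) * E i)"
proof (induction n)
  case (Suc n)
  let ?M = "\<lambda>i j. G i (j-1) - G i j - (G (i-1) (j-1) - G (i-1) j)"
  have t: "(\<Sum>i=1..m. ?M i (Suc n)) = G m n - G m (Suc n)" for m
    by (induction m) (auto simp: assms)
  have "(\<Sum>i=1..Suc n. \<Sum>j=Suc i..Suc n. ?M i j * (E i - E j)) =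
     (\<Sum>i=1..n. (\<Sum>j=Suc i..n. ?M i j * (E i - E j)) + ?M i (Suc n) * (E i - E (Suc n)))"
    by simp
  also have "\<dots> = (\<Sum>i=1..n. (\<Sum>j=Suc i..n. ?M i j * (E i - E j))) + (\<Sum>i=1..n. ?M i (Suc n) * E i)
     - (\<Sum>i=1..n. ?M i (Suc n)) * E (Suc n)"
    by (rule sum_telescope_aux)
  also have "(\<Sum>i=1..n. ?M i (Suc n) * E i) = (\<Sum>i=1..n. (G i n - G (i-1) n) * E i) - (\<Sum>i=1..n. (G i (Suc n) - G (i-1) (Suc n)) * E i)"
    unfolding sum_subtractf[symmetric] by (rule sum.cong) (auto simp: algebra_simps)
  finally have "(\<Sum>i=1..Suc n. \<Sum>j=Suc i..Suc n. ?M i j * (E i - E j)) = 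
    (\<Sum>i=1..n. (\<Sum>j=Suc i..n. ?M i j * (E i - E j))) + ((\<Sum>i=1..n. (G i n - G (i-1) n) * E i) - (\<Sum>i=1..n. (G i (Suc n) - G (i-1) (Suc n)) * E i))
     - (\<Sum>i=1..n. ?M i (Suc n)) * E (Suc n)" .
  then show ?case using Suc unfolding t by (simp add: algebra_simps)
qed simp

context
  fixes D :: "real set" assumes finD: "finite D"
begin

text \<open>
  A filtration with jumps only in \<open>D\<close> depends at time \<open>r\<close> only on \<open>step_index r\<close>, the number of
  jumps up to \<open>r\<close>; \<open>step_index_left\<close> is its left limit.
\<close>

definition "step_index r = card {d\<in>D. d \<le> r}"
definition "step_index_left r = card {d\<in>D. d < r}"

lemma step_index_le: assumes "d \<in> D" shows "d \<le> r \<longleftrightarrow> step_index d \<le> step_index r"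
proof
  assume "d \<le> r"
  then show "step_index d \<le> step_index r" unfolding step_index_def using finD by (intro card_mono) auto
next
  assume le: "step_index d \<le> step_index r"
  show "d \<le> r"
  proof (rule ccontr)
    assume "\<not> d \<le> r"
    then have "{e\<in>D. e \<le> r} \<subset> {e\<in>D. e \<le> d}" using assms by auto
    then have "step_index r < step_index d" unfolding step_index_def using finD by (intro psubset_card_mono) auto
    with le show False by simp
  qed
qed

lemma step_index_left_eq: "step_index_left r = (if r \<in> D then step_index r - 1 else step_index r)"
proof (cases "r \<in> D")
  case True
  then have "{d\<in>D. d \<le> r} = insert r {d\<in>D. d < r}" by auto
  then have "step_index r = Suc (step_index_left r)" unfolding step_index_def step_index_left_def using finD by simp
  then show ?thesis using True by simp
next
  case False
  then have "{d\<in>D. d \<le> r} = {d\<in>D. d < r}" by (auto simp: le_less)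
  then show ?thesis unfolding step_index_def step_index_left_def using False by simp
qed

lemma step_index_bij: "bij_betw step_index D {1..card D}"
proof -
  have inj: "inj_on step_index D" by (rule inj_onI) (metis step_index_le order_antisym order_refl)
  have "step_index ` D \<subseteq> {1..card D}"
  proof
    fix y assume "y \<in> step_index ` D"
    then obtain d where d: "d \<in> D" "y = step_index d" by auto
    then have "{e\<in>D. e \<le> d} \<noteq> {}" by auto
    then have "y > 0" unfolding d step_index_def using finD by (simp add: card_gt_0_iff)
    moreover have "y \<le> card D" unfolding d step_index_def using finD by (intro card_mono) auto
    ultimately show "y \<in> {1..card D}" by auto
  qed
  then have "step_index ` D = {1..card D}" using card_image[OF inj] by (intro card_subset_eq) auto
  with inj show ?thesis unfolding bij_betw_def by auto
qed

lemma eventually_step_index_left: "\<forall>\<^sub>F \<epsilon> in at_right 0. step_index (r - \<epsilon>) = step_index_left r"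
proof -
  have "\<forall>\<^sub>F \<epsilon> in at_right (0::real). \<forall>d\<in>D. d < r \<longrightarrow> d \<le> r - \<epsilon>"
  proof (rule eventually_ball_finite[OF finD], intro ballI)
    fix d
    show "\<forall>\<^sub>F \<epsilon> in at_right (0::real). d < r \<longrightarrow> d \<le> r - \<epsilon>"
    proof (cases "d < r")
      case True
      then have "\<forall>\<^sub>F \<epsilon> in at_right (0::real). \<epsilon> < r - d" by (intro order_tendstoD(2)[OF tendsto_ident_at]) auto
      then show ?thesis by eventually_elim auto
    qed simp
  qed
  moreover have "\<forall>\<^sub>F \<epsilon> in at_right (0::real). \<epsilon> > 0" by (rule eventually_at_right_less)
  ultimately show ?thesis
  proof eventually_elim
    case (elim \<epsilon>)
    then have "{d\<in>D. d \<le> r - \<epsilon>} = {d\<in>D. d < r}" by force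
    then show ?case unfolding step_index_def step_index_left_def by simp
  qed
qed

lemma eventually_step_index_top: "\<forall>\<^sub>F s in at_top. step_index s = card D"
proof -
  have "\<forall>\<^sub>F s in at_top. \<forall>d\<in>D. d \<le> s"
    by (rule eventually_ball_finite[OF finD]) (auto intro: eventually_ge_at_top)
  then show ?thesis
  proof eventually_elim
    case (elim s)
    then have "{d\<in>D. d \<le> s} = D" by auto
    then show ?case unfolding step_index_def by simp
  qed
qed

lemma Lim_eventually_const: "F \<noteq> bot \<Longrightarrow> \<forall>\<^sub>F x in F. f x = c \<Longrightarrow> Lim F f = (c::real)"
  by (rule tendsto_Lim) (auto intro: tendsto_eventually)

lemma persistent_magnitude_step:
  fixes G :: "nat \<Rightarrow> nat \<Rightarrow> nat"
  assumes \<rho>: "\<And>r s. \<rho> r s = G (step_index r) (step_index s)" and G0: "\<And>j. G 0 j = 0"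
  shows "persistent_magnitude \<rho> t =
    (\<Sum>d\<in>D. (real (G (step_index d) (step_index d)) - real (G (step_index d - 1) (step_index d - 1))) * exp (- d * t))"
proof -
  let ?H = "\<lambda>i j. real (G i j)"
  have bm: "bar_mult \<rho> a b = (?H (step_index a) (step_index_left b) - ?H (step_index a) (step_index b)) - (?H (step_index_left a) (step_index_left b) - ?H (step_index_left a) (step_index b))" for a b
    unfolding bar_mult_def \<rho>
  proof (rule Lim_eventually_const)
    show "\<forall>\<^sub>F \<epsilon> in at_right 0. ?H (step_index a) (step_index (b - \<epsilon>)) - ?H (step_index a) (step_index b) - (?H (step_index (a - \<epsilon>)) (step_index (b - \<epsilon>)) - ?H (step_index (a - \<epsilon>)) (step_index b)) =
       (?H (step_index a) (step_index_left b) - ?H (step_index a) (step_index b)) - (?H (step_index_left a) (step_index_left b) - ?H (step_index_left a) (step_index b))"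
      using eventually_step_index_left[of a] eventually_step_index_left[of b] by eventually_elim simp
  qed simp
  have "Lim (at_right 0) (\<lambda>\<epsilon>. real (\<rho> a s) - real (\<rho> (a - \<epsilon>) s)) = ?H (step_index a) (step_index s) - ?H (step_index_left a) (step_index s)" for a s
    unfolding \<rho> by (rule Lim_eventually_const) (use eventually_step_index_left[of a] in \<open>auto elim: eventually_mono\<close>)
  then have im: "inf_bar_mult \<rho> a = ?H (step_index a) (card D) - ?H (step_index_left a) (card D)" for a
    unfolding inf_bar_mult_def by (intro Lim_eventually_const) (use eventually_step_index_top in \<open>auto elim: eventually_mono\<close>)
  define es where "es = inv_into D step_index"
  have es: "bij_betw es {1..card D} D" "\<And>i. i \<in> {1..card D} \<Longrightarrow> step_index (es i) = i"
    unfolding es_def using step_index_bij by (auto intro: bij_betw_inv_into bij_betw_inv_into_right)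
  have esD: "es i \<in> D" if "i \<in> {1..card D}" for i using es(1) that by (auto dest: bij_betwE)
  have esl: "es i < es j \<longleftrightarrow> i < j" if "i \<in> {1..card D}" "j \<in> {1..card D}" for i j
    using step_index_le[OF esD[OF that(2)], of "es i"] es(2) that by (simp add: not_le flip: linorder_not_le)
  let ?E = "\<lambda>i. exp (- es i * t)"
  have "(\<Sum>(a, b) | a < b \<and> bar_mult \<rho> a b \<noteq> 0. bar_mult \<rho> a b * (exp (- a * t) - exp (- b * t)))
     = (\<Sum>(a,b)\<in>D\<times>D. if a < b then bar_mult \<rho> a b * (exp (- a * t) - exp (- b * t)) else 0)"
    using finD by (intro sum.mono_neutral_cong_left) (auto simp: bm step_index_left_eq split: if_splits)
  also have "\<dots> = (\<Sum>a\<in>D. \<Sum>b\<in>D. if a < b then bar_mult \<rho> a b * (exp (- a * t) - exp (- b * t)) else 0)"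
    by (simp add: sum.cartesian_product)
  also have "\<dots> = (\<Sum>i=1..card D. \<Sum>j=1..card D. if es i < es j then bar_mult \<rho> (es i) (es j) * (?E i - ?E j) else 0)"
    unfolding sum.reindex_bij_betw[OF es(1), symmetric] ..
  also have "\<dots> = (\<Sum>i=1..card D. \<Sum>j=1..card D. if i < j then (?H i (j-1) - ?H i j - (?H (i-1) (j-1) - ?H (i-1) j)) * (?E i - ?E j) else 0)"
    by (intro sum.cong refl) (simp add: esl bm step_index_left_eq esD es(2))
  also have "\<dots> = (\<Sum>i=1..card D. \<Sum>j=Suc i..card D. (?H i (j-1) - ?H i j - (?H (i-1) (j-1) - ?H (i-1) j)) * (?E i - ?E j))"
    by (intro sum.cong refl sum.mono_neutral_cong_right) auto
  finally have 1: "(\<Sum>(a, b) | a < b \<and> bar_mult \<rho> a b \<noteq> 0. bar_mult \<rho> a b * (exp (- a * t) - exp (- b * t))) = \<dots>" .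
  have "(\<Sum>a | inf_bar_mult \<rho> a \<noteq> 0. inf_bar_mult \<rho> a * exp (- a * t)) = (\<Sum>a\<in>D. inf_bar_mult \<rho> a * exp (- a * t))"
    using finD by (intro sum.mono_neutral_left) (auto simp: im step_index_left_eq split: if_splits)
  also have "\<dots> = (\<Sum>i=1..card D. inf_bar_mult \<rho> (es i) * ?E i)"
    unfolding sum.reindex_bij_betw[OF es(1), symmetric] ..
  also have "\<dots> = (\<Sum>i=1..card D. (?H i (card D) - ?H (i-1) (card D)) * ?E i)"
    by (intro sum.cong refl) (simp add: im step_index_left_eq esD es(2))
  finally have 2: "(\<Sum>a | inf_bar_mult \<rho> a \<noteq> 0. inf_bar_mult \<rho> a * exp (- a * t)) = \<dots>" .
  have "persistent_magnitude \<rho> t = (\<Sum>i=1..card D. (?H i i - ?H (i-1) (i-1)) * ?E i)"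
    unfolding persistent_magnitude_def 1 2 by (rule sum_telescope) (simp add: G0)
  also have "\<dots> = (\<Sum>i=1..card D. (?H (step_index (es i)) (step_index (es i)) - ?H (step_index (es i) - 1) (step_index (es i) - 1)) * ?E i)"
    by (intro sum.cong refl) (simp add: es(2))
  also have "\<dots> = (\<Sum>d\<in>D. (?H (step_index d) (step_index d) - ?H (step_index d - 1) (step_index d - 1)) * exp (- d * t))"
    by (rule sum.reindex_bij_betw[OF es(1), of "\<lambda>d. (?H (step_index d) (step_index d) - ?H (step_index d - 1) (step_index d - 1)) * exp (- d * t)"])
  finally show ?thesis .
qed

end

text \<open>
  For a finite metric space the definition yields the alternating sum over all nonempty subsets.
\<close>

theorem rips_magnitude_eq_sum:
  fixes X :: "'a::metric_space set"
  assumes fin: "finite X"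
  shows "rips_magnitude TYPE('k::field) X t =
    (\<Sum>A | A \<subseteq> X \<and> A \<noteq> {}. (-1) ^ (card A - 1) * exp (- diameter A * t))"
proof -
  let ?P = "{A. A \<subseteq> X \<and> A \<noteq> {}}"
  have finP: "finite ?P" using fin by simp
  define D where "D = diameter ` ?P"
  have finD: "finite D" unfolding D_def using finP by simp
  define K where "K i = {A \<in> ?P. step_index D (diameter A) \<le> i}" for i
  have rK: "rips_complex X r = K (step_index D r)" for r
    unfolding rips_complex_def K_def using step_index_le[OF finD, of "diameter _" r] fin finite_subset
    by (auto simp: D_def)
  define G where "G k i j =
     fun_space.dim (cycles X (K i) k :: ('a list \<Rightarrow> 'k) set) -
     fun_space.dim (cycles X (K i) k \<inter> boundaries X (K j) k :: ('a list \<Rightarrow> 'k) set)" for k i j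
  have rG: "rips_homology_rank TYPE('k) X k r s = G k (step_index D r) (step_index D s)" for k r s
    unfolding rips_homology_rank_def G_def rK ..
  have cp: "finite_complex X (K i)" for i
  proof
    fix A B assume A: "A \<in> K i" "B \<subseteq> A" "B \<noteq> {}"
    then have "finite A" using fin finite_subset unfolding K_def by auto
    then have "diameter B \<le> diameter A" using A(2) by (intro diameter_subset finite_imp_bounded)
    then have "step_index D (diameter B) \<le> step_index D (diameter A)"
      using step_index_le[OF finD, of "diameter B" "diameter A"] A unfolding D_def K_def by auto
    then show "B \<in> K i" using A unfolding K_def by auto
  qed (use fin in \<open>auto simp: K_def\<close>)
  have idpos: "step_index D (diameter A) > 0" if "A \<in> ?P" for A
  proof -
    have "diameter A \<in> D" unfolding D_def using that by blast
    then have "step_index D (diameter A) \<in> {1..card D}" using bij_betwE[OF step_index_bij[OF finD]] by blast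
    then show ?thesis by simp
  qed
  have "A \<notin> K 0" for A
  proof
    assume "A \<in> K 0"
    then have "A \<in> ?P" "step_index D (diameter A) \<le> 0" unfolding K_def by blast+
    then show False using idpos[of A] by linarith
  qed
  then have K0: "K 0 = {}" by blast
  have G0: "G k 0 j = 0" for k j
  proof -
    interpret c: finite_complex X "K 0" "TYPE('k)" by (rule cp)
    have "c.n i = 0" for i
    proof -
      have "{A\<in>K 0. card A = Suc i} = {}" using K0 by blast
      then show ?thesis by (simp only: c.n_eq card.empty)
    qed
    then have "c.z k = 0" using c.n_0 c.n_Suc by (cases k) auto
    then show ?thesis unfolding G_def c.z_def by simp
  qed
  have eu: "(\<Sum>k<card X. (-1) ^ k * real (G k i i)) = (\<Sum>A\<in>K i. (-1) ^ (card A - 1))" for i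
  proof -
    interpret c: finite_complex X "K i" "TYPE('k)" by (rule cp)
    have "G k i i = c.z k - c.b k" for k
      unfolding G_def c.z_def c.b_def using c.b_sub by (simp add: Int_absorb1)
    then show ?thesis using c.euler by (simp add: K_def)
  qed
  have diff: "(\<Sum>A\<in>K i. (-1) ^ (card A - 1)) - (\<Sum>A\<in>K (i - 1). (-1) ^ (card A - 1)) =
     (\<Sum>A\<in>{A\<in>?P. step_index D (diameter A) = i}. (-1::real) ^ (card A - 1))" if "i > 0" for i
  proof -
    have "K i - K (i - 1) = {A\<in>?P. step_index D (diameter A) = i}" "K (i - 1) \<subseteq> K i" using that unfolding K_def by auto
    moreover have "finite (K i)" unfolding K_def by (rule finite_subset[OF _ finP]) blast
    ultimately show ?thesis using sum_diff[of "K i" "K (i - 1)" "\<lambda>A. (-1::real) ^ (card A - 1)"] by metis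
  qed
  have "rips_magnitude TYPE('k) X t = (\<Sum>k<card X. (- 1) ^ k *
     (\<Sum>d\<in>D. (real (G k (step_index D d) (step_index D d)) - real (G k (step_index D d - 1) (step_index D d - 1))) * exp (- d * t)))"
    unfolding rips_magnitude_def
    by (intro sum.cong refl arg_cong[where f = "(*) _"] persistent_magnitude_step[OF finD]) (rule rG G0)+
  also have "\<dots> = (\<Sum>d\<in>D. \<Sum>k<card X. (- 1) ^ k *
     ((real (G k (step_index D d) (step_index D d)) - real (G k (step_index D d - 1) (step_index D d - 1))) * exp (- d * t)))"
    unfolding sum_distrib_left by (rule sum.swap)
  also have "\<dots> = (\<Sum>d\<in>D. ((\<Sum>k<card X. (- 1) ^ k * real (G k (step_index D d) (step_index D d))) -
      (\<Sum>k<card X. (- 1) ^ k * real (G k (step_index D d - 1) (step_index D d - 1)))) * exp (- d * t))"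
    by (intro sum.cong refl) (rule sum_diff_factor)
  also have "\<dots> = (\<Sum>d\<in>D. (\<Sum>A\<in>{A\<in>?P. diameter A = d}. (-1) ^ (card A - 1) * exp (- diameter A * t)))"
  proof (rule sum.cong[OF refl])
    fix d assume d: "d \<in> D"
    then obtain A where "A \<in> ?P" "d = diameter A" unfolding D_def by blast
    then have "step_index D d > 0" using idpos by metis
    moreover have "{A\<in>?P. step_index D (diameter A) = step_index D d} = {A\<in>?P. diameter A = d}"
    proof -
      have "step_index D (diameter A) = step_index D d \<longleftrightarrow> diameter A = d" if "A \<in> ?P" for A
      proof
        assume e: "step_index D (diameter A) = step_index D d"
        have "diameter A \<in> D" unfolding D_def using that by blast
        then show "diameter A = d" using inj_onD[OF bij_betw_imp_inj_on[OF step_index_bij[OF finD]] e] d by blast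
      qed simp
      then show ?thesis by blast
    qed
    ultimately show "((\<Sum>k<card X. (- 1) ^ k * real (G k (step_index D d) (step_index D d))) -
      (\<Sum>k<card X. (- 1) ^ k * real (G k (step_index D d - 1) (step_index D d - 1)))) * exp (- d * t) =
      (\<Sum>A\<in>{A\<in>?P. diameter A = d}. (-1) ^ (card A - 1) * exp (- diameter A * t))"
      unfolding eu by (subst diff) (auto simp: sum_distrib_right intro!: sum.cong)
  qed
  also have "\<dots> = (\<Sum>A\<in>?P. (-1) ^ (card A - 1) * exp (- diameter A * t))"
    using finP finD by (intro sum.group) (auto simp: D_def)
  finally show ?thesis .
qed

end

theory Submission
  imports Defs
begin

text \<open>
  Write \<open>n = mp\<close>.  Subsets of the \<open>n\<close> points have diameter at most that of a chord of \<open>k\<close> steps, \<open>2k < n\<close>,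
  iff they are cliques of the \<open>k\<close>-th power of the \<open>n\<close>-cycle.  Call a vertex \<open>x\<close> free for a clique \<open>A\<close>
  if some other \<open>b \<in> A\<close> lies at most \<open>k\<close> steps before \<open>x\<close> and no element of \<open>A\<close> is far from any
  point of the arc from \<open>b\<close> to \<open>x\<close>.  Adding or deleting a free vertex gives a clique with the same free
  vertices, so toggling the least one is a sign-reversing involution.  A clique without free
  vertices is closed under rotation by \<open>-k\<close>, which forces it to be a coset of \<open>g\<int>/n\<int>\<close>, \<open>g = n - 2k\<close>,
  with \<open>n / g\<close> odd.  Hence the clique complex has Euler characteristic \<open>g\<close> if \<open>n / g\<close> is odd integral
  and \<open>0\<close> otherwise.  Summation by parts over the chord lengths turns the Rips magnitude into a
  sum over the odd divisors \<open>r = n / g\<close> of \<open>n\<close>: those dividing \<open>m\<close> contribute difference quotients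
  that converge to derivatives, the remaining ones \<open>ps\<close> have bounded weight \<open>m / s\<close> and vanish in
  the limit.
\<close>

section \<open>Arcs, cliques and free vertices on Z/n\<close>

definition arc_len :: "int \<Rightarrow> int \<Rightarrow> int \<Rightarrow> int" where
  "arc_len n a b = (b - a) mod n"

definition circ_cliques :: "int \<Rightarrow> int \<Rightarrow> int set set" where
  "circ_cliques n k = {A. A \<subseteq> {0..<n} \<and> A \<noteq> {} \<and> (\<forall>a\<in>A. \<forall>b\<in>A. \<not> (k < arc_len n a b \<and> arc_len n a b < n - k))}"

text \<open>Measured from \<open>b\<close>, a real position \<open>i\<close> has the far zone
  \<open>(i + k, i + n - k)\<close>. The interval in the last condition is the union of these zones
  for \<open>i\<close> from \<open>0\<close> to \<open>arc_len n b x\<close>. Integer positions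
  alone would miss points when \<open>n = 2 * k + 1\<close>. Without \<open>b \<noteq> x\<close>
  every vertex of a clique would be free.\<close>

definition free_vertices :: "int \<Rightarrow> int \<Rightarrow> int set \<Rightarrow> int set" where
  "free_vertices n k A = {x\<in>{0..<n}. \<exists>b\<in>A. b \<noteq> x \<and> arc_len n b x \<le> k \<and>
     (\<forall>a\<in>A. \<not> (k < arc_len n b a \<and> arc_len n b a < arc_len n b x + n - k))}"

lemma arc_len_bounds: "n > 0 \<Longrightarrow> 0 \<le> arc_len n a b" "n > 0 \<Longrightarrow> arc_len n a b < n"
  by (auto simp: arc_len_def)

lemma arc_len_eq_0: "a \<in> {0..<n} \<Longrightarrow> b \<in> {0..<n} \<Longrightarrow> arc_len n a b = 0 \<longleftrightarrow> a = b"
  unfolding arc_len_def dvd_eq_mod_eq_0[symmetric] mod_eq_dvd_iff[symmetric] by auto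

lemma arc_len_self [simp]: "arc_len n a a = 0"
  by (simp add: arc_len_def)

text \<open>Two arcs have total length below \<open>2 * n\<close>, so reduction modulo
  \<open>n\<close> subtracts \<open>n\<close> at most once. This turns cyclic arguments into linear
  arithmetic.\<close>

lemma arc_len_add:
  assumes "n > 0"
  shows "arc_len n a c = arc_len n a b + arc_len n b c \<or> arc_len n a c = arc_len n a b + arc_len n b c - n"
proof -
  have "arc_len n a c = (arc_len n a b + arc_len n b c) mod n"
    unfolding arc_len_def mod_add_eq by simp
  moreover have "(arc_len n a b + arc_len n b c) mod n = (arc_len n a b + arc_len n b c - n) mod n" by simp
  moreover have "(arc_len n a b + arc_len n b c) mod n = arc_len n a b + arc_len n b c" if "arc_len n a b + arc_len n b c < n"
    using that arc_len_bounds[OF assms] by (intro mod_pos_pos_trivial) auto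
  moreover have "(arc_len n a b + arc_len n b c - n) mod n = arc_len n a b + arc_len n b c - n" if "arc_len n a b + arc_len n b c \<ge> n"
    using that arc_len_bounds(2)[OF assms, of a b] arc_len_bounds(2)[OF assms, of b c] by (intro mod_pos_pos_trivial) linarith+
  ultimately show ?thesis by linarith
qed

text \<open>Inserting \<open>x\<close> could spoil a free vertex only by lying far from its arc, and
  create one only by serving as its witness. The witness \<open>c\<close> of \<open>x\<close>
  contradicts the former and replaces \<open>x\<close> in the latter.\<close>

lemma free_vertices_insert:
  assumes n: "n > 0" "0 \<le> k" "2 * k < n" and A: "A \<subseteq> {0..<n}"
    and x: "x \<in> free_vertices n k A"
  shows "free_vertices n k (insert x A) = free_vertices n k A"
proof (intro equalityI subsetI)
  note ab = arc_len_bounds[OF n(1)] and ad = arc_len_add[OF n(1)]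
  obtain c where c: "c \<in> A" "c \<noteq> x" "arc_len n c x \<le> k"
    "\<And>a. a \<in> A \<Longrightarrow> \<not> (k < arc_len n c a \<and> arc_len n c a < arc_len n c x + n - k)"
    using x unfolding free_vertices_def by blast
  have xV: "x \<in> {0..<n}" using x unfolding free_vertices_def by blast
  {
    fix y assume y: "y \<in> free_vertices n k A"
    then obtain b where b: "b \<in> A" "b \<noteq> y" "arc_len n b y \<le> k"
      "\<And>a. a \<in> A \<Longrightarrow> \<not> (k < arc_len n b a \<and> arc_len n b a < arc_len n b y + n - k)"
      unfolding free_vertices_def by blast
    \<comment> \<open>If \<open>x\<close> is far from the arc from \<open>b\<close> to
      \<open>y\<close>, then \<open>c\<close> lies on the way from \<open>b\<close> to
      \<open>x\<close>, within \<open>k\<close> of \<open>b\<close>. But then \<open>b\<close> is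
      far from the arc from \<open>c\<close> to \<open>x\<close>.\<close>
    have "\<not> (k < arc_len n b x \<and> arc_len n b x < arc_len n b y + n - k)"
    proof
      assume e: "k < arc_len n b x \<and> arc_len n b x < arc_len n b y + n - k"
      have bc: "arc_len n b x = arc_len n b c + arc_len n c x" using ad[of b x c] e c(3) ab(2)[of b c] by linarith
      then have "arc_len n b c \<le> k" using b(4)[OF c(1)] e ab(1)[of c x] by linarith
      moreover have "arc_len n c b = n - arc_len n b c"
        using ad[of b b c] arc_len_self[of n b] bc e c(3) ab(1)[of c b] ab(1)[of b c] by linarith
      ultimately show False using c(4)[OF b(1)] bc e n(3) by linarith
    qed
    then show "y \<in> free_vertices n k (insert x A)"
      using y b unfolding free_vertices_def by blast
  next
    fix y assume y: "y \<in> free_vertices n k (insert x A)"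
    then obtain b where b: "b \<in> insert x A" "b \<noteq> y" "arc_len n b y \<le> k"
      "\<And>a. a \<in> insert x A \<Longrightarrow> \<not> (k < arc_len n b a \<and> arc_len n b a < arc_len n b y + n - k)"
      unfolding free_vertices_def by blast
    have yV: "y \<in> {0..<n}" using y unfolding free_vertices_def by blast
    show "y \<in> free_vertices n k A"
    proof (cases "b = x")
      case False
      then show ?thesis using b yV unfolding free_vertices_def by blast
    next
      case True
      \<comment> \<open>The arcs from \<open>c\<close> to \<open>x\<close> and from \<open>x\<close>
        to \<open>y\<close> join to one of length at most \<open>k\<close>, since otherwise
        \<open>c\<close> would be far from the arc from \<open>x\<close> to
        \<open>y\<close>.\<close>
      have "arc_len n x y \<noteq> 0" using arc_len_eq_0[OF xV yV] b(2) True by simp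
      moreover have "arc_len n c x \<noteq> 0" using arc_len_eq_0[of c n x] xV A c(1,2) by blast
      ultimately have p: "0 < arc_len n x y" "0 < arc_len n c x" using ab(1)[of x y] ab(1)[of c x] by linarith+
      then have cy: "arc_len n c y = arc_len n c x + arc_len n x y"
        using ad[of c y x] c(3) b(3)[unfolded True] n(3) ab[of c y] by linarith
      have "\<not> (k < arc_len n c a \<and> arc_len n c a < arc_len n c y + n - k)" if "a \<in> A" for a
        using c(4)[OF that] b(4)[OF insertI2[OF that], unfolded True] cy ad[of c a x] p(1) n
          b(3)[unfolded True] c(3) ab[of x a] ab[of c a] by linarith
      moreover have "arc_len n c y \<le> k"
        using b(4)[OF insertI2[OF c(1)], unfolded True] ad[of x x c] arc_len_self[of n x] p n cy ab[of x c]
          b(3)[unfolded True] c(3) by linarith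
      moreover have "c \<noteq> y" using cy p by auto
      ultimately show ?thesis using yV c(1) unfolding free_vertices_def by blast
    qed
  }
qed

text \<open>The witness differs from \<open>x\<close>, and \<open>x\<close> lies within
  \<open>k\<close> of it, so \<open>x\<close> never violates its own condition. This carries the
  insertion lemma over to deletions.\<close>

lemma free_vertices_remove_self:
  "x \<in> free_vertices n k (A - {x}) \<longleftrightarrow> x \<in> free_vertices n k A"
proof -
  have "(\<forall>a\<in>A - {x}. \<not> (k < arc_len n b a \<and> arc_len n b a < arc_len n b x + n - k)) \<longleftrightarrow>
      (\<forall>a\<in>A. \<not> (k < arc_len n b a \<and> arc_len n b a < arc_len n b x + n - k))" if "arc_len n b x \<le> k" for b
    using that by (metis DiffI Diff_iff singletonD not_less)
  then show ?thesis unfolding free_vertices_def by auto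
qed

text \<open>The point \<open>x\<close> lies on the arc that ends in it, so all of \<open>A\<close>
  is near \<open>x\<close>. Hence inserting a free vertex preserves cliques.\<close>

lemma free_vertex_compatible:
  assumes n: "n > 0" "0 \<le> k" "2 * k < n" and x: "x \<in> free_vertices n k A" and a: "a \<in> A"
  shows "\<not> (k < arc_len n a x \<and> arc_len n a x < n - k)" "\<not> (k < arc_len n x a \<and> arc_len n x a < n - k)"
proof -
  obtain c where c: "arc_len n c x \<le> k" "\<not> (k < arc_len n c a \<and> arc_len n c a < arc_len n c x + n - k)"
    using x a unfolding free_vertices_def by blast
  show "\<not> (k < arc_len n a x \<and> arc_len n a x < n - k)" "\<not> (k < arc_len n x a \<and> arc_len n x a < n - k)"
    using c n arc_len_add[OF n(1), of c a x] arc_len_add[OF n(1), of x x a] arc_len_bounds[OF n(1), of c x]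
      arc_len_bounds[OF n(1), of x a] arc_len_bounds[OF n(1), of a x] arc_len_bounds[OF n(1), of c a] arc_len_self[of n x] by linarith+
qed

section \<open>The sign-reversing involution\<close>

lemma sum_involution_zero:
  fixes f :: "'a \<Rightarrow> real"
  assumes "\<And>a. a \<in> S \<Longrightarrow> \<tau> a \<in> S" "\<And>a. a \<in> S \<Longrightarrow> \<tau> (\<tau> a) = a" "\<And>a. a \<in> S \<Longrightarrow> f (\<tau> a) = - f a"
  shows "sum f S = 0"
proof -
  have "sum f S = sum (\<lambda>a. f (\<tau> a)) S"
    by (rule sum.reindex_bij_witness[of _ \<tau> \<tau>]) (use assms in auto)
  also have "\<dots> = - sum f S"
    using assms(3) by (simp add: sum_negf)
  finally show ?thesis by simp
qed

lemma sum_cliques_with_free_vertex: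
  assumes n: "n > 0" "0 \<le> k" "2 * k < n"
  shows "(\<Sum>A | A \<in> circ_cliques n k \<and> free_vertices n k A \<noteq> {}. (-1::real) ^ (card A - 1)) = 0"
proof -
  let ?G = "free_vertices n k"
  define \<tau> where "\<tau> A = (let x = Min (?G A) in if x \<in> A then A - {x} else insert x A)" for A
  show ?thesis
  proof (rule sum_involution_zero[where \<tau> = \<tau>])
    fix A assume "A \<in> {A. A \<in> circ_cliques n k \<and> ?G A \<noteq> {}}"
    then have A: "A \<in> circ_cliques n k" "?G A \<noteq> {}" by auto
    have finG: "finite (?G A)" by (rule finite_subset[of _ "{0..<n}"]) (auto simp: free_vertices_def)
    define x where "x = Min (?G A)"
    have x: "x \<in> ?G A" unfolding x_def using finG A(2) by simp
    have AV: "A \<subseteq> {0..<n}" and Ane: "A \<noteq> {}"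
      and cl: "\<And>a b. a \<in> A \<Longrightarrow> b \<in> A \<Longrightarrow> \<not> (k < arc_len n a b \<and> arc_len n a b < n - k)"
      using A(1) unfolding circ_cliques_def by auto
    have finA: "finite A" using AV finite_subset by blast
    have xV: "x \<in> {0..<n}" using x unfolding free_vertices_def by blast
    \<comment> \<open>The witness of \<open>x\<close> differs from \<open>x\<close> and survives the
      deletion.\<close>
    have ne: "A - {x} \<noteq> {}" using x unfolding free_vertices_def by blast
    have \<tau>: "\<tau> A = (if x \<in> A then A - {x} else insert x A)" unfolding \<tau>_def x_def Let_def ..
    have G: "?G (\<tau> A) = ?G A"
    proof (cases "x \<in> A")
      case True
      \<comment> \<open>A deletion is an insertion read backwards, as \<open>x\<close> is free for
        \<open>A - {x}\<close> too.\<close>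
      have "?G (insert x (A - {x})) = ?G (A - {x})"
        using free_vertices_remove_self x AV by (intro free_vertices_insert[OF n]) auto
      then show ?thesis using True unfolding \<tau> by (simp add: insert_absorb)
    next
      case False
      then show ?thesis using free_vertices_insert[OF n AV x] unfolding \<tau> by simp
    qed
    have "\<tau> A \<in> circ_cliques n k"
      using AV ne cl xV free_vertex_compatible[OF n x] n unfolding \<tau> circ_cliques_def by auto
    with G A(2) show "\<tau> A \<in> {A. A \<in> circ_cliques n k \<and> ?G A \<noteq> {}}" by auto
    have "\<tau> (\<tau> A) = (if x \<in> \<tau> A then \<tau> A - {x} else insert x (\<tau> A))"
      unfolding \<tau>_def[of "\<tau> A"] G x_def Let_def ..
    then show "\<tau> (\<tau> A) = A" unfolding \<tau> by auto
    \<comment> \<open>With both cardinalities positive, the truncated subtraction of 1 does not hide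
      the change of parity.\<close>
    have pos: "0 < card A" "0 < card (A - {x})" using Ane ne finA by (auto simp: card_gt_0_iff)
    show "(-1::real) ^ (card (\<tau> A) - 1) = - ((-1) ^ (card A - 1))"
    proof (cases "x \<in> A")
      case True
      obtain j where j: "card (A - {x}) = Suc j" using pos(2) gr0_implies_Suc by blast
      have "card A = Suc (Suc j)" using card.remove[OF finA True] j by simp
      with j True show ?thesis unfolding \<tau> by (simp only: if_True diff_Suc_1 power_Suc)
    next
      case False
      obtain j where "card A = Suc j" using pos(1) gr0_implies_Suc by blast
      then show ?thesis using False finA unfolding \<tau> by simp
    qed
  qed
qed

section \<open>Cliques without free vertices and the Euler characteristic\<close>

lemma clique_without_free_vertex_closed:
  assumes n: "n > 0" "0 \<le> k" "2 * k < n"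
    and A: "A \<in> circ_cliques n k" "free_vertices n k A = {}" and a: "a \<in> A"
  shows "(a - k) mod n \<in> A"
proof (cases "k = 0")
  case True
  then show ?thesis using A(1) a unfolding circ_cliques_def by auto
next
  case False
  have AV: "A \<subseteq> {0..<n}" using A(1) unfolding circ_cliques_def by auto
  define x where "x = (a + 1) mod n"
  have ax: "arc_len n a x = 1"
  proof -
    have "(a + 1) mod n - a = (a + 1) - n * ((a + 1) div n) - a" by (simp add: minus_mult_div_eq_mod)
    also have "\<dots> mod n = 1 mod n" by (simp add: mod_eq_dvd_iff)
    finally show ?thesis unfolding arc_len_def x_def using n False by simp
  qed
  have "x \<in> {0..<n}" unfolding x_def using n by auto
  moreover have "a \<noteq> x" using ax by auto
  moreover have "arc_len n a x \<le> k" using ax False n by simp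
  ultimately obtain b where b: "b \<in> A" "k < arc_len n a b" "arc_len n a b < 1 + n - k"
    using A(2) a unfolding free_vertices_def ax[symmetric] by blast
  have "\<not> (k < arc_len n a b \<and> arc_len n a b < n - k)" using A(1) a b(1) unfolding circ_cliques_def by auto
  then have "arc_len n a b = n - k" using b by linarith
  moreover have "(n - k) mod n = n - k" using n False by (intro mod_pos_pos_trivial) auto
  ultimately have "(b - a) mod n = (n - k) mod n" unfolding arc_len_def by simp
  then have "n dvd (b - a) - (n - k)" unfolding mod_eq_dvd_iff .
  moreover have "b - (a - k) = ((b - a) - (n - k)) + n" by simp
  ultimately have "n dvd b - (a - k)" by (metis dvd_add dvd_refl)
  then have "b mod n = (a - k) mod n" unfolding mod_eq_dvd_iff .
  moreover have "b mod n = b" using b(1) AV by auto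
  ultimately show ?thesis using b(1) by simp
qed

text \<open>Two rotations by \<open>-k\<close> make one by \<open>g = n - 2 * k\<close> modulo
  \<open>n\<close>, so \<open>A\<close> is stable under \<open>g\<close>. The window strictly
  between \<open>k\<close> and \<open>n - k = k + g\<close> misses just one class modulo
  \<open>g\<close>. Shifting a difference by multiples of \<open>g\<close> hits the window unless
  the difference lies in the class of \<open>k\<close>.\<close>

lemma clique_without_free_vertex:
  assumes n: "n > 0" "0 \<le> k" "2 * k < n"
    and A: "A \<in> circ_cliques n k" "free_vertices n k A = {}"
  shows "(n - 2 * k) dvd k" "\<exists>c\<in>{0..<n - 2 * k}. A = {x\<in>{0..<n}. x mod (n - 2 * k) = c}"
proof -
  define g where "g = n - 2 * k"
  have g: "g > 0" using n by (simp add: g_def)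
  have AV: "A \<subseteq> {0..<n}" and Ane: "A \<noteq> {}"
    and cl: "\<And>a b. a \<in> A \<Longrightarrow> b \<in> A \<Longrightarrow> \<not> (k < arc_len n a b \<and> arc_len n a b < n - k)"
    using A(1) unfolding circ_cliques_def by auto
  have step: "(a - int j * k) mod n \<in> A" if "a \<in> A" for a j
  proof (induction j)
    case 0
    then show ?case using that AV by (auto simp: subset_iff)
  next
    case (Suc j)
    from clique_without_free_vertex_closed[OF n A this]
    show ?case by (simp add: mod_diff_left_eq algebra_simps)
  qed
  have cg: "(a + i * g) mod n \<in> A" if "a \<in> A" for a i
  proof -
    \<comment> \<open>Reducing \<open>2 * i\<close> modulo \<open>n\<close> gives a natural number
      of rotations by \<open>-k\<close>, also for negative \<open>i\<close>.\<close>
    have "n dvd (a - int (nat ((2 * i) mod n)) * k) - (a + i * g)"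
    proof -
      have "int (nat ((2 * i) mod n)) = (2 * i) mod n" using n by simp
      also have "\<dots> = 2 * i - n * (2 * i div n)" by (simp add: minus_mult_div_eq_mod)
      finally have q: "int (nat ((2 * i) mod n)) = 2 * i - n * (2 * i div n)" .
      have "(a - int (nat ((2 * i) mod n)) * k) - (a + i * g) = n * ((2 * i div n) * k - i)"
        unfolding q by (simp add: g_def algebra_simps)
      then show ?thesis by simp
    qed
    then show ?thesis using step[OF that, of "nat ((2 * i) mod n)"] by (metis mod_eq_dvd_iff)
  qed
  \<comment> \<open>The number \<open>e\<close> need not be reduced: inside the window it is its own
    residue modulo \<open>n\<close>.\<close>
  have arcg: "\<not> (k < e \<and> e < n - k)" if "a \<in> A" "b \<in> A" "e = a + i * g - b" for a b e i
  proof
    assume e: "k < e \<and> e < n - k"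
    have "arc_len n b ((a + i * g) mod n) = e mod n" unfolding arc_len_def that(3) by (simp add: mod_diff_left_eq)
    also have "\<dots> = e" using e n by simp
    finally show False using cl[OF that(2) cg[OF that(1), of i]] e by simp
  qed
  obtain a where a: "a \<in> A" using Ane by blast
  show gk: "(n - 2 * k) dvd k"
  proof (rule ccontr)
    assume "\<not> (n - 2 * k) dvd k"
    then have "k mod g \<noteq> 0" unfolding g_def dvd_eq_mod_eq_0 .
    moreover have "0 \<le> k mod g" "k mod g < g" using g by simp_all
    ultimately have r: "0 < k mod g" "k mod g < g" by simp_all
    \<comment> \<open>This is the first multiple of \<open>g\<close> above \<open>k\<close>, and it
      falls short of \<open>k + g\<close> when \<open>g\<close> does not divide
      \<open>k\<close>.\<close>
    have "k + g - k mod g = a + (k div g + 1) * g - a" by (simp add: algebra_simps flip: minus_mod_eq_mult_div)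
    from arcg[OF a a this] r show False by (simp add: g_def)
  qed
  have "A = {x\<in>{0..<n}. x mod g = a mod g}"
  proof (intro equalityI subsetI)
    fix b assume b: "b \<in> A"
    have "(b - a) mod g = 0"
    proof (rule ccontr)
      assume "(b - a) mod g \<noteq> 0"
      moreover have "0 \<le> (b - a) mod g" "(b - a) mod g < g" using g by simp_all
      ultimately have r: "0 < (b - a) mod g" "(b - a) mod g < g" by simp_all
      obtain l where l: "k = g * l" using gk unfolding g_def dvd_def by blast
      \<comment> \<open>As \<open>g\<close> divides \<open>k\<close>, this number is congruent to
        \<open>a - b\<close> modulo \<open>g\<close>; a nonzero remainder puts it in the
        window.\<close>
      have "k + g - (b - a) mod g = a + ((b - a) div g + l + 1) * g - b"
        by (simp add: l algebra_simps flip: minus_mod_eq_mult_div)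
      from arcg[OF a b this] r show False by (simp add: g_def)
    qed
    then show "b \<in> {x\<in>{0..<n}. x mod g = a mod g}" using b AV by (auto simp: mod_eq_dvd_iff)
  next
    fix x assume x: "x \<in> {x\<in>{0..<n}. x mod g = a mod g}"
    then have "g dvd x - a" by (simp add: mod_eq_dvd_iff)
    then obtain i where "x - a = g * i" unfolding dvd_def by blast
    then have "x = a + i * g" by (simp add: algebra_simps)
    then show "x \<in> A" using cg[OF a, of i] x by simp
  qed
  then show "\<exists>c\<in>{0..<n - 2 * k}. A = {x\<in>{0..<n}. x mod (n - 2 * k) = c}"
    using g unfolding g_def by (intro bexI[of _ "a mod (n - 2 * k)"]) auto
qed

text \<open>Differences within a class are multiples of \<open>g\<close>, and none lies strictly
  between \<open>k\<close> and \<open>k + g\<close>. Writing \<open>k = g * l\<close> gives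
  \<open>n = g * (2 * l + 1)\<close>, hence the odd size.\<close>

lemma residue_class_clique:
  assumes n: "n > 0" "0 \<le> k" "2 * k < n" and gk: "(n - 2 * k) dvd k" and c: "c \<in> {0..<n - 2 * k}"
  defines "A \<equiv> {x\<in>{0..<n}. x mod (n - 2 * k) = c}"
  shows "A \<in> circ_cliques n k" "free_vertices n k A = {}" "odd (card A)"
proof -
  define g where "g = n - 2 * k"
  have g: "g > 0" using n by (simp add: g_def)
  obtain l where l: "k = g * l" using gk unfolding g_def dvd_def by blast
  have nl: "n = g * (2 * l + 1)" using l by (simp add: g_def algebra_simps)
  have l0: "l \<ge> 0" using l n g by (simp add: zero_le_mult_iff)
  have gn: "g dvd n" using nl by simp
  have cA: "c \<in> A" using c n unfolding A_def by auto
  have arc_len_dvd: "g dvd arc_len n a b \<longleftrightarrow> g dvd b - a" for a b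
    unfolding arc_len_def using gn by (simp add: dvd_mod_iff)
  show "A \<in> circ_cliques n k"
  proof -
    have "\<not> (k < arc_len n a b \<and> arc_len n a b < n - k)" if "a \<in> A" "b \<in> A" for a b
    proof
      assume e: "k < arc_len n a b \<and> arc_len n a b < n - k"
      have "b mod g = a mod g" using that unfolding A_def g_def by simp
      then have "g dvd arc_len n a b" unfolding arc_len_dvd by (simp add: mod_eq_dvd_iff)
      then have "g dvd arc_len n a b - k" using gk by (simp add: g_def)
      moreover have "0 < arc_len n a b - k" "arc_len n a b - k < g" using e by (auto simp: g_def)
      ultimately show False using zdvd_imp_le by fastforce
    qed
    then show ?thesis using cA unfolding circ_cliques_def A_def by auto
  qed
  show "free_vertices n k A = {}"
  proof (rule ccontr)
    assume "free_vertices n k A \<noteq> {}"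
    then obtain x b where x: "x \<in> {0..<n}" "b \<in> A" "b \<noteq> x" "arc_len n b x \<le> k"
      "\<And>a. a \<in> A \<Longrightarrow> \<not> (k < arc_len n b a \<and> arc_len n b a < arc_len n b x + n - k)"
      unfolding free_vertices_def by blast
    have bV: "b \<in> {0..<n}" "b mod g = c" using x(2) unfolding A_def g_def by auto
    have p: "0 < arc_len n b x" using arc_len_eq_0[OF bV(1) x(1)] x(3) arc_len_bounds[OF n(1), of b x] by auto
    \<comment> \<open>This is \<open>b - k\<close> modulo \<open>n\<close>. It stays in the class
      and is far from every nontrivial arc starting at \<open>b\<close>.\<close>
    define a where "a = (b + (n - k)) mod n"
    have "a mod g = (b + (n - k)) mod g" unfolding a_def using gn by (simp add: mod_mod_cancel)
    also have "\<dots> = b mod g" using l nl by (simp add: mod_eq_dvd_iff)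
    finally have aA: "a \<in> A" using bV n unfolding A_def a_def g_def by auto
    have "arc_len n b a = (b + (n - k) - b) mod n" unfolding a_def arc_len_def mod_diff_left_eq ..
    also have "\<dots> = (n - k) mod n" by (simp only: add_diff_cancel_left')
    also have "\<dots> = n - k" using p x(4) n by (intro mod_pos_pos_trivial) linarith+
    finally show False using x(5)[OF aA] p n by simp
  qed
  have "bij_betw (\<lambda>i. c + i * g) {0..<2 * l + 1} A"
  proof (rule bij_betwI[where g = "\<lambda>x. x div g"])
    have cg: "0 \<le> c" "c < g" using c by (auto simp: g_def)
    show "(\<lambda>i. c + i * g) \<in> {0..<2 * l + 1} \<rightarrow> A"
    proof
      fix i assume i: "i \<in> {0..<2 * l + 1}"
      have "c + i * g < g + i * g" using cg by simp
      also have "\<dots> = (i + 1) * g" by (simp add: algebra_simps)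
      also have "\<dots> \<le> (2 * l + 1) * g" using i g by (intro mult_right_mono) auto
      also have "\<dots> = n" using nl by (simp add: algebra_simps)
      finally show "c + i * g \<in> A" using cg i g unfolding A_def g_def[symmetric] by auto
    qed
    show "(\<lambda>x. x div g) \<in> A \<rightarrow> {0..<2 * l + 1}"
    proof
      fix x assume "x \<in> A"
      then have "0 \<le> x" "x < g * (2 * l + 1)" using nl unfolding A_def by auto
      moreover have "g * (x div g) \<le> x" using pos_mod_sign[OF g, of x] minus_mult_div_eq_mod[of x g] by linarith
      ultimately have "g * (x div g) < g * (2 * l + 1)" by linarith
      then show "x div g \<in> {0..<2 * l + 1}" using g \<open>0 \<le> x\<close>
        by (auto simp: pos_imp_zdiv_nonneg_iff mult_less_cancel_left_pos)
    qed
    show "(c + i * g) div g = i" if "i \<in> {0..<2 * l + 1}" for i using cg by simp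
    show "c + x div g * g = x" if "x \<in> A" for x using that unfolding A_def g_def[symmetric]
      by (metis (mono_tags, lifting) mem_Collect_eq mod_mult_div_eq mult.commute)
  qed
  then have "card A = card {0..<2 * l + 1}" by (rule bij_betw_same_card[symmetric])
  also have "\<dots> = 2 * nat l + 1" using l0 by simp
  finally show "odd (card A)" by simp
qed

text \<open>After the cancellation only residue classes modulo \<open>g = n - 2 * k\<close> remain,
  each of odd size and so of sign \<open>+1\<close>. Divisibility of \<open>k\<close> by
  \<open>g\<close> means that \<open>n / g\<close> is an odd integer.\<close>

lemma circ_cliques_euler:
  assumes n: "n > 0" "0 \<le> k" "2 * k < n"
  shows "(\<Sum>A\<in>circ_cliques n k. (-1::real) ^ (card A - 1)) =
    (if (n - 2 * k) dvd k then of_int (n - 2 * k) else 0)"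
proof -
  let ?G = "free_vertices n k" and ?f = "\<lambda>A::int set. (-1::real) ^ (card A - 1)"
  define g where "g = n - 2 * k"
  define R where "R c = {x\<in>{0..<n}. x mod g = c}" for c
  let ?C0 = "{A\<in>circ_cliques n k. ?G A = {}}"
  have fin: "finite (circ_cliques n k)"
    by (rule finite_subset[of _ "Pow {0..<n}"]) (auto simp: circ_cliques_def)
  have "sum ?f (circ_cliques n k) = sum ?f ?C0 + (\<Sum>A | A \<in> circ_cliques n k \<and> ?G A \<noteq> {}. ?f A)"
    using fin by (subst sum.union_disjoint[symmetric]) (auto intro!: sum.cong)
  also have "\<dots> = sum ?f ?C0" using sum_cliques_with_free_vertex[OF n] by simp
  also have "\<dots> = (if g dvd k then of_int g else 0)"
  proof (cases "g dvd k")
    case True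
    have "?C0 \<subseteq> R ` {0..<g}"
      using clique_without_free_vertex(2)[OF n] unfolding R_def g_def by blast
    moreover have "R ` {0..<g} \<subseteq> ?C0"
      using residue_class_clique(1,2)[OF n True[unfolded g_def]] unfolding R_def g_def by blast
    ultimately have "?C0 = R ` {0..<g}" by (rule equalityI)
    moreover have "inj_on R {0..<g}"
    proof (rule inj_onI)
      fix c d assume cd: "c \<in> {0..<g}" "d \<in> {0..<g}" "R c = R d"
      have "c < n" using cd(1) n by (simp add: g_def)
      then have "c \<in> R c" unfolding R_def using cd(1) by simp
      then have "c \<in> R d" using cd(3) by simp
      then have "c mod g = d" unfolding R_def by simp
      then show "c = d" using cd(1) by simp
    qed
    ultimately have "sum ?f ?C0 = (\<Sum>c\<in>{0..<g}. ?f (R c))" by (simp add: sum.reindex)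
    also have "\<dots> = (\<Sum>c\<in>{0..<g}. 1)"
      using residue_class_clique(3)[OF n True[unfolded g_def]] unfolding R_def g_def by (intro sum.cong) simp_all
    also have "\<dots> = of_int g" using n by (simp add: g_def)
    finally show ?thesis using True by simp
  next
    case False
    then have "?C0 = {}" using clique_without_free_vertex(1)[OF n] unfolding g_def by auto
    then show ?thesis using False by (simp only: sum.empty if_False)
  qed
  finally show ?thesis by (simp only: g_def)
qed

section \<open>Chords and diameters on the circle\<close>

definition circle_point :: "nat \<Rightarrow> int \<Rightarrow> real^2" where
  "circle_point n i = vector [cos (2 * pi * of_int i / real n), sin (2 * pi * of_int i / real n)]"

definition chord :: "nat \<Rightarrow> int \<Rightarrow> real" where
  "chord n i = 2 * sin (pi * of_int i / real n)"

lemma circle_points_eq: "circle_points n = circle_point n ` {0..<int n}"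
  unfolding circle_points_def circle_point_def image_int_atLeastLessThan[of 0 n, simplified, symmetric]
  by (simp add: image_image lessThan_atLeast0)

lemma dist_circle_point:
  assumes n: "n > 0"
  shows "dist (circle_point n a) (circle_point n b) = chord n (arc_len (int n) a b)"
proof -
  define x y where "x = 2 * pi * of_int a / real n" and "y = 2 * pi * of_int b / real n"
  define e q where "e = arc_len (int n) a b" and "q = (b - a) div int n"
  have half: "(cos x - cos y)\<^sup>2 + (sin x - sin y)\<^sup>2 = (2 * sin ((y - x) / 2))\<^sup>2"
  proof -
    have "(cos x - cos y)\<^sup>2 + (sin x - sin y)\<^sup>2 = 2 - 2 * cos (y - x)"
      using sin_cos_squared_add[of x] sin_cos_squared_add[of y]
      by (simp add: cos_diff power2_eq_square algebra_simps)
    also have "cos (y - x) = 1 - 2 * (sin ((y - x) / 2))\<^sup>2"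
      using cos_double_sin[of "(y - x) / 2"] by (simp only: nonzero_mult_div_cancel_left times_divide_eq_right)
    finally show ?thesis by (simp add: power2_eq_square)
  qed
  have "b - a = e + int n * q" by (simp add: e_def q_def arc_len_def)
  then have "(of_int b :: real) - of_int a = of_int e + real n * of_int q"
    by (metis of_int_add of_int_diff of_int_mult of_int_of_nat_eq)
  then have yx: "(y - x) / 2 = pi * of_int e / real n + pi * of_int q"
    using n unfolding x_def y_def by (simp add: field_simps)
  \<comment> \<open>Full turns shift the half angle by multiples of \<open>pi\<close>, which affects
    only the sign of the sine.\<close>
  have "\<bar>sin ((y - x) / 2)\<bar> = \<bar>sin (pi * of_int e / real n)\<bar>"
    unfolding yx sin_add by (simp add: abs_mult)
  also have "\<dots> = sin (pi * of_int e / real n)"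
    using arc_len_bounds[of "int n" a b] n unfolding e_def[symmetric]
    by (intro abs_of_nonneg sin_ge_zero) (auto simp: field_simps)
  finally have "sqrt ((cos x - cos y)\<^sup>2 + (sin x - sin y)\<^sup>2) = chord n e"
    unfolding half real_sqrt_abs chord_def by (simp add: abs_mult)
  then show ?thesis
    unfolding dist_vec_def L2_set_def circle_point_def
    by (simp add: sum_2 dist_real_def e_def flip: x_def y_def)
qed

lemma chord_le_iff_half:
  assumes n: "n > 0" and "0 \<le> i" "2 * i \<le> int n" "0 \<le> j" "2 * j \<le> int n"
  shows "chord n i \<le> chord n j \<longleftrightarrow> i \<le> j"
proof -
  have "pi * of_int k / real n \<le> pi / 2" if "2 * k \<le> int n" for k
  proof -
    have "2 * of_int k \<le> real n" using that by linarith
    then show ?thesis using n by (simp add: field_simps)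
  qed
  moreover have "- (pi / 2) \<le> pi * of_int k / real n" if "0 \<le> k" for k
    using that pi_ge_zero by (intro order.trans[OF _ divide_nonneg_nonneg]) auto
  ultimately have "chord n i \<le> chord n j \<longleftrightarrow> pi * of_int i / real n \<le> pi * of_int j / real n"
    unfolding chord_def using assms by (simp add: sin_mono_le_eq)
  also have "\<dots> \<longleftrightarrow> i \<le> j" using n by (simp add: field_simps)
  finally show ?thesis .
qed

lemma chord_reflect: "n > 0 \<Longrightarrow> chord n (int n - i) = chord n i"
proof -
  assume n: "n > 0"
  have "pi * of_int (int n - i) / real n = pi - pi * of_int i / real n" using n by (simp add: field_simps)
  then show ?thesis unfolding chord_def by (simp only: sin_pi_minus)
qed

text \<open>Chords grow up to half a turn and are symmetric under replacing \<open>e\<close> by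
  \<open>n - e\<close>. This translates distances into the window of
  \<open>circ_cliques\<close>.\<close>

lemma chord_le_iff:
  assumes n: "n > 0" and e: "0 \<le> e" "e < int n" and k: "0 \<le> k" "2 * k \<le> int n"
  shows "chord n e \<le> chord n k \<longleftrightarrow> \<not> (k < e \<and> e < int n - k)"
proof (cases "2 * e \<le> int n")
  case True
  then show ?thesis using chord_le_iff_half[OF n e(1) True k] k by linarith
next
  case False
  then show ?thesis using chord_le_iff_half[OF n _ _ k, of "int n - e"] e k chord_reflect[OF n, of e] by simp linarith
qed

lemma inj_circle_point: "n > 0 \<Longrightarrow> inj_on (circle_point n) {0..<int n}"
proof (rule inj_onI)
  fix a b assume n: "n > 0" and ab: "a \<in> {0..<int n}" "b \<in> {0..<int n}" "circle_point n a = circle_point n b"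
  then have "chord n (arc_len (int n) a b) = chord n 0" using dist_circle_point[OF n, of a b] by (simp add: chord_def)
  then have "arc_len (int n) a b = 0"
    using chord_le_iff[OF n, of "arc_len (int n) a b" 0] arc_len_bounds[of "int n" a b] n by simp
  then show "a = b" using arc_len_eq_0[OF ab(1,2)] by simp
qed

text \<open>A finite set attains its diameter at a pair of points, whose arc is reflected if it
  exceeds half a turn. Bounding the diameter bounds all pairwise chords.\<close>

lemma diameter_circle_points:
  assumes n: "n > 0" and A: "A \<subseteq> {0..<int n}" "A \<noteq> {}"
  shows "\<exists>h. 0 \<le> h \<and> 2 * h \<le> int n \<and> diameter (circle_point n ` A) = chord n h"
    and "0 \<le> k \<Longrightarrow> 2 * k \<le> int n \<Longrightarrow>
      diameter (circle_point n ` A) \<le> chord n k \<longleftrightarrow> A \<in> circ_cliques (int n) k"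
proof -
  let ?P = "circle_point n ` A"
  have fin: "finite ?P" using A finite_subset by blast
  have "\<exists>x\<in>?P. \<exists>y\<in>?P. dist x y = diameter ?P"
    using diameter_compact_attained[OF finite_imp_compact[OF fin]] A(2) by simp
  then obtain a b where "dist (circle_point n a) (circle_point n b) = diameter ?P" by auto
  then have ab: "diameter ?P = chord n (arc_len (int n) a b)" by (simp add: dist_circle_point[OF n])
  show "\<exists>h. 0 \<le> h \<and> 2 * h \<le> int n \<and> diameter ?P = chord n h"
  proof (cases "2 * arc_len (int n) a b \<le> int n")
    case True
    then show ?thesis using ab arc_len_bounds[of "int n"] n by auto
  next
    case False
    then show ?thesis using ab arc_len_bounds[of "int n" a b] n chord_reflect[OF n]
      by (intro exI[of _ "int n - arc_len (int n) a b"]) auto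
  qed
  assume k: "0 \<le> k" "2 * k \<le> int n"
  have "diameter ?P \<le> chord n k \<longleftrightarrow> (\<forall>x\<in>?P. \<forall>y\<in>?P. dist x y \<le> chord n k)"
  proof
    assume "diameter ?P \<le> chord n k"
    then show "\<forall>x\<in>?P. \<forall>y\<in>?P. dist x y \<le> chord n k"
      using diameter_bounded_bound[OF finite_imp_bounded[OF fin]] order.trans by blast
  next
    assume "\<forall>x\<in>?P. \<forall>y\<in>?P. dist x y \<le> chord n k"
    then show "diameter ?P \<le> chord n k" using A(2) by (intro diameter_le) (auto simp: dist_norm)
  qed
  also have "\<dots> \<longleftrightarrow> (\<forall>a\<in>A. \<forall>b\<in>A. \<not> (k < arc_len (int n) a b \<and> arc_len (int n) a b < int n - k))"
    using chord_le_iff[OF n arc_len_bounds _ _] n k by (simp add: dist_circle_point[OF n])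
  also have "\<dots> \<longleftrightarrow> A \<in> circ_cliques (int n) k"
    using A unfolding circ_cliques_def by simp
  finally show "diameter ?P \<le> chord n k \<longleftrightarrow> A \<in> circ_cliques (int n) k" .
qed

section \<open>From the alternating sum to a sum over odd divisors\<close>

text \<open>Expand the product of \<open>-1 + 1\<close> over \<open>V\<close> and split off the term
  \<open>1\<close> of the empty set.\<close>

lemma sum_sign_nonempty_subsets:
  assumes "finite V" "V \<noteq> {}"
  shows "(\<Sum>A | A \<subseteq> V \<and> A \<noteq> {}. (-1::real) ^ (card A - 1)) = 1"
proof -
  have "(\<Sum>A\<in>Pow V. (-1::real) ^ card A) = (\<Prod>v\<in>V. -1 + 1)"
    using assms(1) by (subst prod_add) auto
  also have "\<dots> = 0" using assms by (simp add: card_gt_0_iff)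
  finally have 0: "(\<Sum>A\<in>Pow V. (-1::real) ^ card A) = 0" .
  have "(\<Sum>A\<in>Pow V. (-1::real) ^ card A) = 1 + (\<Sum>A\<in>Pow V - {{}}. (-1) ^ card A)"
    using assms(1) by (subst sum.remove[of _ "{}"]) auto
  also have "(\<Sum>A\<in>Pow V - {{}}. (-1::real) ^ card A) = (\<Sum>A | A \<subseteq> V \<and> A \<noteq> {}. - ((-1) ^ (card A - 1)))"
  proof (rule sum.cong)
    fix A assume "A \<in> {A. A \<subseteq> V \<and> A \<noteq> {}}"
    then have "finite A" "A \<noteq> {}" using assms(1) finite_subset by auto
    then have "card A \<noteq> 0" by simp
    then show "(-1::real) ^ card A = - ((-1) ^ (card A - 1))" by (cases "card A") auto
  qed auto
  finally show ?thesis using 0 by (simp add: sum_negf)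
qed

text \<open>Summation by parts over the chord lengths makes the coefficient of
  \<open>E k - E (Suc k)\<close> the Euler characteristic of the clique complex at \<open>k\<close>.
  At the top length all nonempty subsets count, with total \<open>1\<close>.\<close>

lemma rips_magnitude_circle_points:
  fixes t :: real
  assumes n: "n > 0"
  defines "E \<equiv> \<lambda>k. exp (- chord n (int k) * t)"
  shows "rips_magnitude TYPE('k::field) (circle_points n) t =
    E (n div 2) + (\<Sum>k<n div 2. (if (n - 2 * k) dvd k then real (n - 2 * k) else 0) * (E k - E (Suc k)))"
proof -
  let ?K = "n div 2" and ?V = "{0..<int n}"
  let ?S = "{A. A \<subseteq> ?V \<and> A \<noteq> {}}" and ?s = "\<lambda>A. (-1::real) ^ (card A - 1)"
  \<comment> \<open>If the diameter is the chord of \<open>h\<close> steps, \<open>A\<close> is a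
    clique exactly from \<open>k = h\<close> on, and the sum telescopes to
    \<open>E h - E ?K\<close>.\<close>
  have exp_diam: "exp (- diameter (circle_point n ` A) * t) =
      E ?K + (\<Sum>k<?K. if A \<in> circ_cliques (int n) (int k) then E k - E (Suc k) else 0)" if "A \<in> ?S" for A
  proof -
    have A: "A \<subseteq> ?V" "A \<noteq> {}" using that by auto
    obtain h' where h': "0 \<le> h'" "2 * h' \<le> int n" "diameter (circle_point n ` A) = chord n h'"
      using diameter_circle_points(1)[OF n A] by blast
    define h where "h = nat h'"
    have h: "h \<le> ?K" "diameter (circle_point n ` A) = chord n (int h)" using h' by (auto simp: h_def)
    have "A \<in> circ_cliques (int n) (int k) \<longleftrightarrow> h \<le> k" if "k < ?K" for k
      using diameter_circle_points(2)[OF n A, of "int k"] chord_le_iff_half[OF n, of "int h" "int k"] that h by simp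
    then have "(\<Sum>k<?K. if A \<in> circ_cliques (int n) (int k) then E k - E (Suc k) else 0) =
        (\<Sum>k<?K. if h \<le> k then E k - E (Suc k) else 0)" by (intro sum.cong) auto
    also have "\<dots> = (\<Sum>k=h..<?K. E k - E (Suc k))"
      by (intro sum.mono_neutral_cong_right) auto
    also have "\<dots> = E h - E ?K"
      using sum_Suc_diff'[OF h(1), of "\<lambda>k. - E k"] by simp
    finally show ?thesis unfolding h(2) E_def by simp
  qed
  have fS: "finite ?S" by (rule finite_subset[of _ "Pow ?V"]) auto
  have "rips_magnitude TYPE('k) (circle_points n) t =
      (\<Sum>A | A \<subseteq> circle_points n \<and> A \<noteq> {}. ?s A * exp (- diameter A * t))"
    by (rule rips_magnitude_eq_sum) (simp add: circle_points_eq)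
  also have "{A. A \<subseteq> circle_points n \<and> A \<noteq> {}} = (`) (circle_point n) ` ?S"
    unfolding circle_points_eq by (auto simp: subset_image_iff)
  also have "(\<Sum>A\<in>\<dots>. ?s A * exp (- diameter A * t)) =
      (\<Sum>A\<in>?S. ?s (circle_point n ` A) * exp (- diameter (circle_point n ` A) * t))"
    using inj_on_image_Pow[OF inj_circle_point[OF n]]
    by (intro sum.reindex[unfolded o_def]) (auto intro: inj_on_subset)
  also have "\<dots> = (\<Sum>A\<in>?S. ?s A * (E ?K + (\<Sum>k<?K. if A \<in> circ_cliques (int n) (int k) then E k - E (Suc k) else 0)))"
  proof (rule sum.cong[OF refl])
    fix A assume A: "A \<in> ?S"
    then have "card (circle_point n ` A) = card A"
      using inj_on_subset[OF inj_circle_point[OF n]] by (intro card_image) blast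
    then show "?s (circle_point n ` A) * exp (- diameter (circle_point n ` A) * t) =
        ?s A * (E ?K + (\<Sum>k<?K. if A \<in> circ_cliques (int n) (int k) then E k - E (Suc k) else 0))"
      by (simp only: exp_diam[OF A])
  qed
  also have "\<dots> = (\<Sum>A\<in>?S. ?s A) * E ?K +
      (\<Sum>A\<in>?S. \<Sum>k<?K. ?s A * (if A \<in> circ_cliques (int n) (int k) then E k - E (Suc k) else 0))"
    by (simp only: distrib_left sum.distrib sum_distrib_right sum_distrib_left)
  also have "(\<Sum>A\<in>?S. ?s A) = 1" using n by (intro sum_sign_nonempty_subsets) auto
  also have "(\<Sum>A\<in>?S. \<Sum>k<?K. ?s A * (if A \<in> circ_cliques (int n) (int k) then E k - E (Suc k) else 0)) =
      (\<Sum>k<?K. \<Sum>A\<in>?S. ?s A * (if A \<in> circ_cliques (int n) (int k) then E k - E (Suc k) else 0))"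
    by (rule sum.swap)
  also have "\<dots> = (\<Sum>k<?K. (if (n - 2 * k) dvd k then real (n - 2 * k) else 0) * (E k - E (Suc k)))"
  proof (rule sum.cong[OF refl])
    fix k assume "k \<in> {..<?K}"
    then have k: "2 * k < n" by auto
    have "(\<Sum>A\<in>?S. ?s A * (if A \<in> circ_cliques (int n) (int k) then E k - E (Suc k) else 0)) =
        (\<Sum>A\<in>circ_cliques (int n) (int k). ?s A * (E k - E (Suc k)))"
      using fS by (intro sum.mono_neutral_cong_right) (auto simp: circ_cliques_def)
    also have "\<dots> = (\<Sum>A\<in>circ_cliques (int n) (int k). ?s A) * (E k - E (Suc k))"
      by (rule sum_distrib_right[symmetric])
    also have "(\<Sum>A\<in>circ_cliques (int n) (int k). ?s A) =
        (if (int n - 2 * int k) dvd int k then of_int (int n - 2 * int k) else 0)"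
      using k by (intro circ_cliques_euler) auto
    also have "int n - 2 * int k = int (n - 2 * k)" using k by simp
    finally show "(\<Sum>A\<in>?S. ?s A * (if A \<in> circ_cliques (int n) (int k) then E k - E (Suc k) else 0)) =
        (if (n - 2 * k) dvd k then real (n - 2 * k) else 0) * (E k - E (Suc k))" by (simp only: int_dvd_int_iff of_int_of_nat_eq)
  qed
  finally show ?thesis by simp
qed

text \<open>Substitute \<open>r = n / g\<close> with \<open>g = n - 2 * k\<close>. Then
  \<open>k = g * (r div 2)\<close> and \<open>pi * k / n = pi / 2 - pi / (2 * r)\<close>, so sines
  become cosines.\<close>

lemma rips_magnitude_circle_points_divisors:
  assumes n: "n > 0"
  shows "rips_magnitude TYPE('k::field) (circle_points n) t =
    exp (- 2 * t * sin (pi * real (n div 2) / real n)) +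
    (\<Sum>r | odd r \<and> r dvd n. real n / real r *
       (exp (- 2 * t * cos (pi / (2 * real r))) - exp (- 2 * t * cos (pi / (2 * real r) - pi / real n))))"
proof -
  define E where "E k = exp (- chord n (int k) * t)" for k
  define D where "D r = exp (- 2 * t * cos (pi / (2 * real r))) - exp (- 2 * t * cos (pi / (2 * real r) - pi / real n))" for r
  let ?R = "{r. odd r \<and> r dvd n}"
  have finR: "finite ?R" using n by (auto intro: finite_subset[of _ "{..n}"] dvd_imp_le)
  have "(\<Sum>k<n div 2. (if (n - 2 * k) dvd k then real (n - 2 * k) else 0) * (E k - E (Suc k))) =
      (\<Sum>k | k < n div 2 \<and> (n - 2 * k) dvd k. real (n - 2 * k) * (E k - E (Suc k)))"
    by (intro sum.mono_neutral_cong_right) auto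
  \<comment> \<open>The bound \<open>k < n div 2\<close> forces \<open>g \<ge> 2\<close>, so
    \<open>r = n\<close> does not occur.\<close>
  also have "\<dots> = (\<Sum>r\<in>?R - {n}. real n / real r * D r)"
  proof (rule sum.reindex_bij_witness[of _ "\<lambda>r. n div r * (r div 2)" "\<lambda>k. n div (n - 2 * k)"])
    fix k assume "k \<in> {k. k < n div 2 \<and> (n - 2 * k) dvd k}"
    then have k: "k < n div 2" "(n - 2 * k) dvd k" by auto
    define g where "g = n - 2 * k"
    obtain l where l: "k = g * l" using k(2) unfolding g_def dvd_def by blast
    have g2: "g \<ge> 2" using k(1) by (simp add: g_def)
    have nl: "n = g * (2 * l + 1)" using l k(1) by (simp add: g_def)
    have "n div g = 2 * l + 1" using g2 by (subst nl) simp
    then have r: "n div (n - 2 * k) = 2 * l + 1" by (simp only: g_def)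
    show "n div (n - 2 * k) \<in> ?R - {n}" 
    proof -
      have "2 * l + 1 dvd n" by (subst nl) (rule dvd_triv_right)
      moreover have "2 * l + 1 \<noteq> n" using mult_le_mono1[OF g2, of "2 * l + 1", folded nl] by simp
      ultimately show ?thesis unfolding r by simp
    qed
    have "n div (2 * l + 1) = g" by (subst nl) (rule nonzero_mult_div_cancel_right, simp)
    then show "n div (n div (n - 2 * k)) * (n div (n - 2 * k) div 2) = k" unfolding r using l by simp
    have "real g = real n / real (2 * l + 1)"
      by (subst nl, subst of_nat_mult, rule nonzero_mult_div_cancel_right[symmetric]) simp
    then have gr: "real (n - 2 * k) = real n / real (2 * l + 1)" by (simp only: g_def)
    have half: "pi * ((N - N / w) / 2) / N = pi / 2 - pi / (2 * w)" if "N \<noteq> 0" "w \<noteq> 0" for N w :: real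
      using that by (simp add: field_simps)
    have rk: "real k = (real n - real n / real (2 * l + 1)) / 2"
      using k(1) by (simp only: gr[symmetric]) (simp add: of_nat_diff)
    have kn: "pi * real k / real n = pi / 2 - pi / (2 * real (2 * l + 1))"
      unfolding rk by (rule half) (use n in simp_all)
    have E1: "E k = exp (- 2 * t * cos (pi / (2 * real (2 * l + 1))))"
    proof -
      have "sin (pi * real k / real n) = cos (pi / (2 * real (2 * l + 1)))"
        by (simp only: kn cos_sin_eq of_real_eq_id id_apply)
      then show ?thesis unfolding E_def chord_def by simp
    qed
    have E2: "E (Suc k) = exp (- 2 * t * cos (pi / (2 * real (2 * l + 1)) - pi / real n))"
    proof -
      have "pi * real (Suc k) / real n = pi / 2 - (pi / (2 * real (2 * l + 1)) - pi / real n)"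
        using kn by (simp add: distrib_left add_divide_distrib)
      then have "sin (pi * real (Suc k) / real n) = cos (pi / (2 * real (2 * l + 1)) - pi / real n)" by (simp only: cos_sin_eq of_real_eq_id id_apply)
      then show ?thesis unfolding E_def chord_def by simp
    qed
    show "real n / real (n div (n - 2 * k)) * D (n div (n - 2 * k)) = real (n - 2 * k) * (E k - E (Suc k))"
      unfolding r gr E1 E2 D_def ..
  next
    fix r assume "r \<in> ?R - {n}"
    then have r: "odd r" "r dvd n" "r \<noteq> n" by auto
    obtain l where l: "r = 2 * l + 1" using r(1) oddE by blast
    obtain g where g: "n = r * g" using r(2) by blast
    have "g \<noteq> 0" "g \<noteq> 1" using g r(3) n by auto
    then have g2: "g \<ge> 2" by linarith
    have "n div r = g" unfolding g by (rule nonzero_mult_div_cancel_left) (simp add: l)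
    then have k: "n div r * (r div 2) = g * l" using l by simp
    have ngl: "n = 2 * (g * l) + g" unfolding g l by (simp add: algebra_simps)
    then have gl: "n - 2 * (g * l) = g" by simp
    show "n div r * (r div 2) \<in> {k. k < n div 2 \<and> (n - 2 * k) dvd k}"
      unfolding k mem_Collect_eq gl using g2 ngl by simp
    show "n div (n - 2 * (n div r * (r div 2))) = r" unfolding k gl using g g2 by simp
  qed
  also have "\<dots> = (\<Sum>r\<in>?R. real n / real r * D r)"
  proof -
    \<comment> \<open>At \<open>r = n\<close> the two angles are opposite and cosine is even, so the
      missing term may be added.\<close>
    have "D n = 0"
    proof -
      have "pi / (2 * real n) - pi / real n = - (pi / (2 * real n))" using n by (simp add: field_simps)
      then show ?thesis unfolding D_def by (simp only: cos_minus)
    qed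
    then show ?thesis using finR by (intro sum.mono_neutral_left) auto
  qed
  finally show ?thesis
    using rips_magnitude_circle_points[OF n, where 'k = 'k and t = t] by (simp add: E_def D_def chord_def mult_ac)
qed

section \<open>The limit along the primes\<close>

theorem theorem9p2:
  fixes m :: nat and t :: real
  assumes "m > 0" and "t > 0"
  shows "((\<lambda>p. rips_magnitude TYPE('k::field) (circle_points (m * p)) t) \<longlongrightarrow>
            exp (- 2 * t) + 2 * pi * t *
              (\<Sum>r | odd r \<and> r dvd m.
                 1 / real r * exp (- 2 * t * cos (pi / (2 * real r))) * sin (pi / (2 * real r))))
          (inf sequentially (principal {p::nat. prime p}))"
proof -
  let ?F = "inf sequentially (principal {p::nat. prime p})"
  let ?R = "{r. odd r \<and> r dvd m}"
  define f where "f x = exp (- 2 * t * cos x)" for x :: real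
  have finR: "finite ?R" using assms(1) by (auto intro: finite_subset[of _ "{..m}"] dvd_imp_le)
  have mult_lim: "filterlim (\<lambda>p. m * p) sequentially sequentially"
    using assms(1) by (intro filterlim_at_top_mono[OF filterlim_ident]) (auto intro!: eventually_sequentiallyI)
  have inv0: "(\<lambda>p. c / real (m * p)) \<longlonglongrightarrow> 0" for c :: real
    by (rule filterlim_compose[OF lim_const_over_n mult_lim])
  have top: "(\<lambda>p. exp (- 2 * t * sin (pi * real (m * p div 2) / real (m * p)))) \<longlonglongrightarrow> exp (- 2 * t)"
  proof -
    \<comment> \<open>The ratio tends to one half, so the angle tends to \<open>pi / 2\<close>,
      where the sine is \<open>1\<close>.\<close>
    have "(\<lambda>n. real (n div 2) / real n) \<longlonglongrightarrow> 1 / 2"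
    proof (rule tendsto_sandwich)
      show "\<forall>\<^sub>F n in sequentially. 1 / 2 - 1 / real n \<le> real (n div 2) / real n"
      proof (rule eventually_sequentiallyI[of 1])
        fix n :: nat assume "1 \<le> n"
        then have "1 / 2 - 1 / real n = (real n - 2) / 2 / real n" by (simp add: field_simps)
        also have "\<dots> \<le> real (n div 2) / real n" 
        proof (rule divide_right_mono)
          have "real n \<le> 2 * real (n div 2) + 2" by linarith
          then show "(real n - 2) / 2 \<le> real (n div 2)" by simp
        qed simp
        finally show "1 / 2 - 1 / real n \<le> real (n div 2) / real n" .
      qed
      show "\<forall>\<^sub>F n in sequentially. real (n div 2) / real n \<le> 1 / 2"
        by (rule eventually_sequentiallyI[of 1]) (simp add: field_simps)
      show "(\<lambda>n. 1 / 2 - 1 / real n) \<longlonglongrightarrow> 1 / 2"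
        using tendsto_diff[OF tendsto_const lim_const_over_n[of 1], of "1 / 2 :: real"] by simp
    qed simp
    from filterlim_compose[OF this mult_lim]
    have "(\<lambda>p. exp (- 2 * t * sin (pi * (real (m * p div 2) / real (m * p))))) \<longlonglongrightarrow> exp (- 2 * t * sin (pi * (1 / 2)))"
      by (intro tendsto_exp tendsto_mult tendsto_sin tendsto_const)
    then show ?thesis by (simp add: mult.assoc)
  qed
  \<comment> \<open>Each term is \<open>pi / r\<close> times a difference quotient of
    \<open>f\<close> at \<open>pi / (2 * r)\<close> with increment
    \<open>- pi / (m * p)\<close>.\<close>
  have main: "(\<lambda>p. real (m * p) / real r * (f (pi / (2 * real r)) - f (pi / (2 * real r) - pi / real (m * p))))
      \<longlonglongrightarrow> 2 * pi * t * (1 / real r * exp (- 2 * t * cos (pi / (2 * real r))) * sin (pi / (2 * real r)))"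
    if "r \<in> ?R" for r
  proof -
    define a where "a = pi / (2 * real r)"
    have "(f has_real_derivative 2 * t * sin a * f a) (at a)"
      unfolding f_def by (auto intro!: derivative_eq_intros)
    then have "((\<lambda>h. (f (a + h) - f a) / h) \<longlongrightarrow> 2 * t * sin a * f a) (at 0)"
      by (simp add: DERIV_def)
    moreover have "filterlim (\<lambda>p. - pi / real (m * p)) (at 0) sequentially"
      unfolding filterlim_at using inv0[of "- pi"] assms(1)
      by (auto intro!: eventually_sequentiallyI[of 1])
    ultimately have "(\<lambda>p. (f (a + - pi / real (m * p)) - f a) / (- pi / real (m * p))) \<longlonglongrightarrow> 2 * t * sin a * f a"
      by (rule filterlim_compose)
    then have "(\<lambda>p. pi / real r * ((f (a + - pi / real (m * p)) - f a) / (- pi / real (m * p))))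
        \<longlonglongrightarrow> pi / real r * (2 * t * sin a * f a)" by (intro tendsto_mult tendsto_const)
    \<comment> \<open>Division by zero yields zero, so the identity also covers
      \<open>N = 0\<close>, which occurs at \<open>p = 0\<close>.\<close>
    moreover have "pi / real r * ((u - v) / (- pi / N)) = N / real r * (v - u)" for u v N :: real
      by (cases "N = 0"; cases "r = 0") (simp_all add: field_simps)
    ultimately have "(\<lambda>p. real (m * p) / real r * (f a - f (a - pi / real (m * p)))) \<longlonglongrightarrow>
        pi / real r * (2 * t * sin a * f a)" by simp
    then show ?thesis unfolding a_def[symmetric] by (simp add: f_def mult_ac)
  qed
  \<comment> \<open>Here the weight is the constant \<open>m / s\<close>, and both angles tend to
    \<open>0\<close>, so the difference of values of \<open>f\<close> vanishes.\<close>
  have rest: "(\<lambda>p. real (m * p) / real (p * s) * (f (pi / (2 * real (p * s))) - f (pi / (2 * real (p * s)) - pi / real (m * p))))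
      \<longlonglongrightarrow> 0" if "s \<in> ?R" for s
  proof -
    have s: "s > 0" using that assms(1) by (auto intro: Nat.gr0I)
    have p0: "(\<lambda>p. pi / (2 * real (p * s))) \<longlonglongrightarrow> 0"
      using tendsto_mult[OF tendsto_const[of "pi / (2 * real s)"] lim_const_over_n[of 1]] by (simp add: field_simps)
    have "(\<lambda>p. f (pi / (2 * real (p * s))) - f (pi / (2 * real (p * s)) - pi / real (m * p))) \<longlonglongrightarrow> 
        exp (- 2 * t * cos 0) - exp (- 2 * t * cos (0 - 0))"
      unfolding f_def by (intro tendsto_intros p0 inv0)
    from tendsto_mult[OF tendsto_const[of "real m / real s"] this]
    have "(\<lambda>p. real m / real s * (f (pi / (2 * real (p * s))) - f (pi / (2 * real (p * s)) - pi / real (m * p)))) \<longlonglongrightarrow> 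
        0" by simp
    moreover have "\<forall>\<^sub>F p in sequentially. real m / real s * d p = real (m * p) / real (p * s) * d p" for d :: "nat \<Rightarrow> real"
      by (rule eventually_sequentiallyI[of 1]) simp
    ultimately show ?thesis by (rule Lim_transform_eventually)
  qed
  \<comment> \<open>\<open>M\<close> converges along all natural numbers; it is identified with the
    magnitude for large primes.\<close>
  define M where "M p = exp (- 2 * t * sin (pi * real (m * p div 2) / real (m * p))) +
      ((\<Sum>r\<in>?R. real (m * p) / real r * (f (pi / (2 * real r)) - f (pi / (2 * real r) - pi / real (m * p)))) +
       (\<Sum>s\<in>?R. real (m * p) / real (p * s) * (f (pi / (2 * real (p * s))) - f (pi / (2 * real (p * s)) - pi / real (m * p)))))" for p
  have "M \<longlonglongrightarrow> exp (- 2 * t) + ((\<Sum>r\<in>?R. 2 * pi * t * (1 / real r * exp (- 2 * t * cos (pi / (2 * real r))) * sin (pi / (2 * real r)))) + (\<Sum>s\<in>?R. 0))"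
    unfolding M_def by (intro tendsto_add top tendsto_sum main rest)
  then have M: "M \<longlonglongrightarrow> exp (- 2 * t) + 2 * pi * t * (\<Sum>r\<in>?R. 1 / real r * exp (- 2 * t * cos (pi / (2 * real r))) * sin (pi / (2 * real r)))"
    by (simp add: sum_distrib_left)
  have "\<forall>\<^sub>F p in ?F. M p = rips_magnitude TYPE('k) (circle_points (m * p)) t"
    unfolding eventually_inf_principal
  \<comment> \<open>The threshold gives \<open>p > m\<close>, so \<open>p\<close> divides no divisor
    of \<open>m\<close>, and \<open>p > 2\<close>, so the prime \<open>p\<close> is odd.\<close>
  proof (rule eventually_sequentiallyI[of "m + 3"], intro impI)
    fix p assume p: "m + 3 \<le> p" "p \<in> {p. prime p}"
    then have pr: "prime p" and "p > 2" by auto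
    then have op: "odd p" using prime_odd_nat by blast
    have pm: "\<not> p dvd r" if "r \<in> ?R" for r
      using that p(1) assms(1) dvd_imp_le[of p m] dvd_trans[of p r m] by auto
    have div: "{r. odd r \<and> r dvd m * p} = ?R \<union> (\<lambda>s. p * s) ` ?R"
    proof (intro equalityI subsetI)
      fix r assume "r \<in> {r. odd r \<and> r dvd m * p}"
      then have r: "odd r" "r dvd m * p" by auto
      show "r \<in> ?R \<union> (\<lambda>s. p * s) ` ?R"
      proof (cases "p dvd r")
        case True
        then obtain s where s: "r = p * s" by blast
        then have "s dvd m" using r(2) \<open>p > 2\<close> by (simp add: mult.commute)
        then show ?thesis using s r(1) by auto
      next
        case False
        then have "coprime r p" using pr by (simp add: coprime_commute prime_imp_coprime)
        then show ?thesis using r by (simp add: coprime_dvd_mult_left_iff)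
      qed
    next
      fix r assume "r \<in> ?R \<union> (\<lambda>s. p * s) ` ?R"
      then show "r \<in> {r. odd r \<and> r dvd m * p}" using op by (auto simp: mult.commute[of p] intro: mult_dvd_mono)
    qed
    have dis: "?R \<inter> (\<lambda>s. p * s) ` ?R = {}" using pm dvd_triv_left by blast
    have inj: "inj_on (\<lambda>s. p * s) ?R" using \<open>p > 2\<close> by (auto simp: inj_on_def)
    have "m * p > 0" using assms(1) \<open>p > 2\<close> by simp
    from rips_magnitude_circle_points_divisors[OF this, where 'k = 'k and t = t]
    show "M p = rips_magnitude TYPE('k) (circle_points (m * p)) t"
      unfolding div sum.union_disjoint[OF finR finite_imageI[OF finR] dis] sum.reindex[OF inj] o_def M_def f_def by simp
  qed
  then show ?thesis
    by (rule Lim_transform_eventually[OF tendsto_mono[OF inf_le1 M]])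
qed

end
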